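(* Let $k>0$, $b>0$, and suppose that the point $C$ lies below the point $A$ on the line $\Gamma$, i.e. $y_C<y_A$. Consider the time-optimal problem with the state constraint $y\ge kx-b$. Then the optimal synthesis is as follows. (i) For starting points in $Q_1$ the optimal trajectories are the same as in the free problem (the problem without the state constraint). (ii) For starting points in $\operatorname{int}Q_2$ any optimal trajectory is of the following type $N'NAO$, with control $u=(-1,\,ky,\,+1)$: it moves with $u=-1$ from the starting point $N'$ to a point $N$ of the open line interval $(A,E)\subset\Gamma$, then along $\Gamma$ with $u=ky$ from $N$ to $A$, and then with $u=+1$ from $A$ to the origin $O$. (iii) For starting points lying on the open interval $(A,E)$ of $\Gamma$, the optimal trajectories are the tails of optimal trajectories starting from $\operatorname{int}Q_2$ whose first leg is the motion with $u=-1$ to a point on $(A,E)$.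
   Context: Problem: on $[0,T]$ with $T$ free, $\dot x=y$, $\dot y=u$, $x(0)=x_0$, $y(0)=y_0$, $x(T)=0$, $y(T)=0$, $|u|\le 1$, $T\to\min$, under the state constraint $y\ge kx-b$ on $[0,T]$. Controls $u$ are measurable; $x,y$ are Lipschitz. The free problem is the same problem without the state constraint. $O=(0,0)$. $\Gamma$ is the line $y=kx-b$. $S$ is the switching curve of the free problem, the union of the semi-parabolas $x=-\tfrac12y^2,\ y\ge0$ and $x=\tfrac12y^2,\ y\le0$. Characteristic points: $A=(x_A,y_A)$ is the intersection of $\Gamma$ and $S$, with $y_A=\frac{1-\sqrt{2bk+1}}{k}$, $x_A=\frac12y_A^2$; $E=(b/k,0)$; $C=(x_C,y_C)=\left(\frac{kb-1}{k^2},-\frac1k\right)$ is the point where $\Gamma$ is tangent to a parabola of the family $x=-\frac12y^2+\mathrm{const}$. Sets (note that the parabola of the family $x=-\frac12y^2+\mathrm{const}$ through $A$ is $x=-\frac12y^2+y_A^2$): $Q_1$ is the closed set of points on the left of $\Gamma$ and of the arc $x=-\frac12y^2+y_A^2$, $y\ge y_A$: that is, all $(x,y)$ with $y\ge kx-b$ and, if $y\ge y_A$, also $x\le y_A^2-\frac12y^2$. $Q_2$ is the closed set bounded by the arc $x=-\frac12y^2+y_A^2$ ($y\ge y_A$), the arc $x=-\frac12y^2+\frac bk$ ($y\ge0$) and the segment $[A,E]$ of $\Gamma$: that is, all $(x,y)$ with $y\ge y_A$, $x\ge y_A^2-\frac12y^2$, and $x\le\frac bk-\frac12y^2$ if $y\ge0$,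 $x\le\frac{y+b}{k}$ if $y_A\le y\le0$. *)

theory Defs
  imports "HOL-Analysis.Analysis"
begin

text \<open>
  A process \<open>(T, x, y, u)\<close> lives on \<open>[0,T]\<close>; the values of the functions outside \<open>[0,T]\<close> are
  irrelevant. Controls are elements of \<open>L\<^sup>\<infinity>\<close>, so conditions on \<open>u\<close> are imposed almost everywhere.
  \<open>T = 0\<close> is allowed, so that the origin itself is a legitimate starting point.
\<close>

definition free_admissible ::
    "real \<times> real \<Rightarrow> real \<Rightarrow> (real \<Rightarrow> real) \<Rightarrow> (real \<Rightarrow> real) \<Rightarrow> (real \<Rightarrow> real) \<Rightarrow> bool" where
  "free_admissible P T x y u \<longleftrightarrow>
     0 \<le> T \<and>
     u \<in> borel_measurable (lebesgue_on {0..T}) \<and>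
     (AE t in lebesgue_on {0..T}. \<bar>u t\<bar> \<le> 1) \<and>
     (\<exists>L. L-lipschitz_on {0..T} x) \<and>
     (\<exists>L. L-lipschitz_on {0..T} y) \<and>
     (AE t in lebesgue_on {0..T}. (x has_real_derivative y t) (at t within {0..T})) \<and>
     (AE t in lebesgue_on {0..T}. (y has_real_derivative u t) (at t within {0..T})) \<and>
     (x 0, y 0) = P \<and>
     (x T, y T) = (0, 0)"

definition admissible ::
    "real \<Rightarrow> real \<Rightarrow> real \<times> real \<Rightarrow> real \<Rightarrow> (real \<Rightarrow> real) \<Rightarrow> (real \<Rightarrow> real) \<Rightarrow> (real \<Rightarrow> real) \<Rightarrow> bool" where
  "admissible k b P T x y u \<longleftrightarrow>
     free_admissible P T x y u \<and> (\<forall>t\<in>{0..T}. y t \<ge> k * x t - b)"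

definition free_optimal ::
    "real \<times> real \<Rightarrow> real \<Rightarrow> (real \<Rightarrow> real) \<Rightarrow> (real \<Rightarrow> real) \<Rightarrow> (real \<Rightarrow> real) \<Rightarrow> bool" where
  "free_optimal P T x y u \<longleftrightarrow>
     free_admissible P T x y u \<and>
     (\<forall>T' x' y' u'. free_admissible P T' x' y' u' \<longrightarrow> T \<le> T')"

definition optimal ::
    "real \<Rightarrow> real \<Rightarrow> real \<times> real \<Rightarrow> real \<Rightarrow> (real \<Rightarrow> real) \<Rightarrow> (real \<Rightarrow> real) \<Rightarrow> (real \<Rightarrow> real) \<Rightarrow> bool" where
  "optimal k b P T x y u \<longleftrightarrow>
     admissible k b P T x y u \<and>
     (\<forall>T' x' y' u'. admissible k b P T' x' y' u' \<longrightarrow> T \<le> T')"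

definition Gamma_line :: "real \<Rightarrow> real \<Rightarrow> (real \<times> real) set" where
  "Gamma_line k b = {(x, y). y = k * x - b}"

text \<open>
  \<open>(x_A, y_A)\<close> is the point where \<open>\<Gamma>\<close> meets the switching curve of the free problem: \<open>y_A\<close> is the
  negative root of \<open>y = k * (y\<^sup>2 / 2) - b\<close>.
\<close>

definition y_A :: "real \<Rightarrow> real \<Rightarrow> real" where
  "y_A k b = (1 - sqrt (2 * b * k + 1)) / k"

definition pt_A :: "real \<Rightarrow> real \<Rightarrow> real \<times> real" where
  "pt_A k b = ((y_A k b)\<^sup>2 / 2, y_A k b)"

definition pt_E :: "real \<Rightarrow> real \<Rightarrow> real \<times> real" where
  "pt_E k b = (b / k, 0)"

text \<open>The point where \<open>\<Gamma>\<close> is tangent to a parabola \<open>x = - y\<^sup>2 / 2 + const\<close>.\<close>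

definition pt_C :: "real \<Rightarrow> real \<Rightarrow> real \<times> real" where
  "pt_C k b = ((k * b - 1) / k\<^sup>2, - (1 / k))"

text \<open>The parabola of the family \<open>x = - y\<^sup>2 / 2 + const\<close> through \<open>(x_A, y_A)\<close> has constant \<open>y_A\<^sup>2\<close>.\<close>

definition Q1 :: "real \<Rightarrow> real \<Rightarrow> (real \<times> real) set" where
  "Q1 k b = {(x, y). y \<ge> k * x - b \<and> (y \<ge> y_A k b \<longrightarrow> x \<le> (y_A k b)\<^sup>2 - y\<^sup>2 / 2)}"

definition Q2 :: "real \<Rightarrow> real \<Rightarrow> (real \<times> real) set" where
  "Q2 k b = {(x, y). y \<ge> y_A k b \<and> x \<ge> (y_A k b)\<^sup>2 - y\<^sup>2 / 2 \<and>
                     (y \<ge> 0 \<longrightarrow> x \<le> b / k - y\<^sup>2 / 2) \<and>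
                     (y_A k b \<le> y \<and> y \<le> 0 \<longrightarrow> x \<le> (y + b) / k)}"

definition first_leg ::
    "real \<Rightarrow> real \<Rightarrow> real \<Rightarrow> (real \<Rightarrow> real) \<Rightarrow> (real \<Rightarrow> real) \<Rightarrow> (real \<Rightarrow> real) \<Rightarrow> bool" where
  "first_leg k b t1 x y u \<longleftrightarrow>
     0 < t1 \<and>
     (AE t in lebesgue_on {0..t1}. u t = -1) \<and>
     (x t1, y t1) \<in> open_segment (pt_A k b) (pt_E k b)"

text \<open>
  Type \<open>N'NAO\<close>, where \<open>N' = (x 0, y 0)\<close> and \<open>N = (x t1, y t1)\<close>; arrival at the origin at
  time \<open>T\<close> is part of admissibility.
\<close>

definition type_NNAO ::
    "real \<Rightarrow> real \<Rightarrow> real \<Rightarrow> (real \<Rightarrow> real) \<Rightarrow> (real \<Rightarrow> real) \<Rightarrow> (real \<Rightarrow> real) \<Rightarrow> bool" where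
  "type_NNAO k b T x y u \<longleftrightarrow>
     (\<exists>t1 t2. t1 < t2 \<and> t2 < T \<and>
        first_leg k b t1 x y u \<and>
        (\<forall>t\<in>{t1..t2}. (x t, y t) \<in> Gamma_line k b) \<and>
        (AE t in lebesgue_on {t1..t2}. u t = k * y t) \<and>
        (x t2, y t2) = pt_A k b \<and>
        (AE t in lebesgue_on {t2..T}. u t = 1))"

definition is_tail ::
    "real \<Rightarrow> real \<Rightarrow> (real \<Rightarrow> real) \<Rightarrow> (real \<Rightarrow> real) \<Rightarrow> (real \<Rightarrow> real) \<Rightarrow>
     real \<Rightarrow> (real \<Rightarrow> real) \<Rightarrow> (real \<Rightarrow> real) \<Rightarrow> (real \<Rightarrow> real) \<Rightarrow> bool" where
  "is_tail s T x y u T' x' y' u' \<longleftrightarrow>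
     0 \<le> s \<and> s \<le> T' \<and> T = T' - s \<and>
     (\<forall>t\<in>{0..T}. x t = x' (s + t) \<and> y t = y' (s + t)) \<and>
     (AE t in lebesgue_on {0..T}. u t = u' (s + t))"

end

theory Submission
  imports Defs
begin

text \<open>
  Both problems are settled by one comparison argument, which replaces the maximum principle and
  gives existence, optimality and uniqueness together.

  Time is measured backward from the arrival at the origin. The candidate trajectory uses \<open>u = 1\<close> for
  remaining times in \<open>[0,a]\<close>, runs along \<open>\<Gamma>\<close> with \<open>u = k y\<close> for remaining times in \<open>[a,W]\<close>, and uses
  \<open>u = -1\<close> for remaining times in \<open>[W,T]\<close>. Let a competitor from the same starting point take no longer,
  and let it wait at the origin until time \<open>T\<close>. Since its velocity is 1-Lipschitz and has the
  prescribed values at both ends, it is at least the candidate's velocity on \<open>[0,a]\<close> and on \<open>[W,T]\<close>. So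
  the difference \<open>\<delta>\<close> of the positions (competitor minus candidate) is at most \<open>0\<close> at \<open>a\<close> and at least \<open>0\<close>
  at \<open>W\<close>. On \<open>[a,W]\<close> the state constraint, with which the candidate complies with equality, makes
  \<open>exp (k w) * \<delta> w\<close> nonincreasing in the remaining time \<open>w\<close>. All these inequalities must then be equalities,
  and the competitor coincides with the candidate (\<open>backward_comparison\<close>, \<open>go_uniquely_fastest\<close>). With \<open>W = a\<close>
  no constraint is used, and the free problem is covered, up to reflection in the origin.

  It remains to see where the candidates start and that they are admissible. The condition \<open>y_C < y_A\<close>
  means \<open>k a < 1\<close> for \<open>a = - y_A\<close>. Hence \<open>\<bar>k y\<bar> < 1\<close> on \<open>[A,E]\<close>, and \<open>k x - y\<close> decreases in \<open>y\<close> along the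
  parabolas of \<open>u = -1\<close> above the height of \<open>A\<close>. The free optimal trajectories from \<open>Q1\<close> therefore respect the
  constraint (\<open>Q1_reference\<close>), and the parabola through an interior point of \<open>Q2\<close> reaches \<open>\<Gamma>\<close> inside \<open>(A,E)\<close>
  without leaving the admissible half-plane (\<open>interior_Q2_go\<close>). Points of \<open>(A,E)\<close> are the case \<open>T = W\<close>, and
  tails of candidates are candidates.
\<close>

section \<open>Statements holding almost everywhere on an interval\<close>

lemma AE_lebesgue_on_Icc_iff_negligible:
  fixes a b :: real
  shows "(AE t in lebesgue_on {a..b}. Q t) \<longleftrightarrow> negligible {t \<in> {a..b}. \<not> Q t}"
proof -
  have "(AE t in lebesgue_on {a..b}. Q t) \<longleftrightarrow> (AE t in lebesgue. t \<in> {a..b} \<longrightarrow> Q t)"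
    by (rule AE_restrict_space_iff) auto
  also have "\<dots> \<longleftrightarrow> {t \<in> {a..b}. \<not> Q t} \<in> null_sets lebesgue"
    by (subst completion.AE_iff_null_sets) (simp add: Collect_conj_eq)
  finally show ?thesis
    by (simp add: negligible_iff_null_sets)
qed

lemma AE_lebesgue_on_Icc_subset_finite:
  fixes a b c d :: real
  assumes ae: "AE t in lebesgue_on {a..b}. Q t" and sub: "a \<le> c" "d \<le> b" and F: "finite F"
    and R: "\<And>t. t \<in> {c..d} \<Longrightarrow> t \<notin> F \<Longrightarrow> Q t \<Longrightarrow> R t"
  shows "AE t in lebesgue_on {c..d}. R t"
proof -
  have "negligible ({t \<in> {a..b}. \<not> Q t} \<union> F)"
    using ae F by (simp add: AE_lebesgue_on_Icc_iff_negligible negligible_finite)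
  thus ?thesis
    unfolding AE_lebesgue_on_Icc_iff_negligible
    by (rule negligible_subset) (use sub R in auto)
qed

lemma AE_lebesgue_on_Icc_subset:
  fixes a b c d :: real
  assumes "AE t in lebesgue_on {a..b}. Q t" "a \<le> c" "d \<le> b"
    and "\<And>t. t \<in> {c..d} \<Longrightarrow> Q t \<Longrightarrow> R t"
  shows "AE t in lebesgue_on {c..d}. R t"
  by (rule AE_lebesgue_on_Icc_subset_finite[OF assms(1-3) finite.emptyI assms(4)])

lemma AE_lebesgue_on_Icc_shift:
  fixes s T :: real
  assumes "AE t in lebesgue_on {0..T}. Q t" "0 \<le> s"
  shows "AE t in lebesgue_on {0..T - s}. Q (s + t)"
proof -
  have "negligible ((+) (- s) ` {t \<in> {0..T}. \<not> Q t})"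
    using assms by (intro negligible_translation) (simp add: AE_lebesgue_on_Icc_iff_negligible)
  moreover have "{t \<in> {0..T - s}. \<not> Q (s + t)} \<subseteq> (+) (- s) ` {t \<in> {0..T}. \<not> Q t}"
  proof
    fix t assume "t \<in> {t \<in> {0..T - s}. \<not> Q (s + t)}"
    thus "t \<in> (+) (- s) ` {t \<in> {0..T}. \<not> Q t}"
      using assms(2) by (intro image_eqI[of _ _ "s + t"]) auto
  qed
  ultimately show ?thesis
    unfolding AE_lebesgue_on_Icc_iff_negligible by (rule negligible_subset)
qed

lemma AE_lebesgue_on_Icc_finite:
  fixes a b :: real
  assumes "finite F" and "\<And>t. t \<in> {a..b} \<Longrightarrow> t \<notin> F \<Longrightarrow> Q t"
  shows "AE t in lebesgue_on {a..b}. Q t"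
  unfolding AE_lebesgue_on_Icc_iff_negligible
  using assms by (intro negligible_subset[OF negligible_finite[of F]]) auto

section \<open>Derivatives and monotonicity on compact intervals\<close>

lemma has_real_derivative_time_reversal:
  fixes f :: "real \<Rightarrow> real"
  assumes "(f has_real_derivative D) (at (T - t) within {0..T})"
  shows "((\<lambda>t. f (T - t)) has_real_derivative - D) (at t within {0..T})"
proof -
  have "(f has_real_derivative D) (at (T - t) within (\<lambda>t. T - t) ` {0..T})"
    using assms by simp
  moreover have "((\<lambda>t. T - t) has_real_derivative -1) (at t within {0..T})"
    by (auto intro!: derivative_eq_intros)
  ultimately have "((f \<circ> (\<lambda>t. T - t)) has_real_derivative D * -1) (at t within {0..T})"
    by (rule DERIV_image_chain)
  thus ?thesis by (simp add: o_def)
qed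

lemma has_real_derivative_glue_Icc:
  fixes f g D E :: "real \<Rightarrow> real"
  assumes f: "\<And>w. w \<in> {p..c} \<Longrightarrow> (f has_real_derivative D w) (at w within {p..c})"
    and g: "\<And>w. w \<in> {c..q} \<Longrightarrow> (g has_real_derivative E w) (at w within {c..q})"
    and eq: "f c = g c" "D c = E c" and pcq: "p \<le> c" "c \<le> q" and w: "w \<in> {p..q}"
  shows "((\<lambda>w. if w \<le> c then f w else g w) has_real_derivative (if w \<le> c then D w else E w))
           (at w within {p..q})"
proof -
  have cl: "closure {p..c} \<inter> closure {c..q} = {c}" "{p..c} \<union> {c} = {p..c}"
    "{c..q} \<union> {c} = {c..q}" and un: "{p..c} \<union> {c..q} = {p..q}"
    using pcq by auto
  have "((\<lambda>x. if x \<in> {p..c} then f x else g x) has_derivative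
          (if w \<in> {p..c} then (\<lambda>w. (*) (D w)) w else (\<lambda>w. (*) (E w)) w)) (at w within {p..c} \<union> {c..q})"
  proof (rule has_derivative_If_within_closures[where f' = "\<lambda>w. (*) (D w)" and g' = "\<lambda>w. (*) (E w)"], unfold cl)
    show "(f has_derivative (*) (D w)) (at w within {p..c})" if "w \<in> {p..c}"
      using f[OF that] by (simp add: has_field_derivative_def)
    show "(g has_derivative (*) (E w)) (at w within {c..q})" if "w \<in> {c..q}"
      using g[OF that] by (simp add: has_field_derivative_def)
    show "f w = g w" "(*) (D w) = (*) (E w)" if "w \<in> closure {p..c}" "w \<in> closure {c..q}"
    proof -
      have "w = c" using that by auto
      thus "f w = g w" "(*) (D w) = (*) (E w)" using eq by auto
    qed
    show "w \<in> {p..c} \<union> {c..q}" using w un by simp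
  qed
  hence *: "((\<lambda>x. if x \<in> {p..c} then f x else g x) has_real_derivative
          (if w \<le> c then D w else E w)) (at w within {p..q})"
    using w unfolding un has_field_derivative_def by (cases "w \<le> c") auto
  show ?thesis
    by (rule has_field_derivative_transform_within[OF * zero_less_one w]) auto
qed

lemma nonincreasing_if_deriv_nonpos_Icc:
  fixes f :: "real \<Rightarrow> real"
  assumes der: "\<And>w. w \<in> {p..q} \<Longrightarrow> (f has_real_derivative D w) (at w within {p..q})"
    and nonpos: "\<And>w. w \<in> {s..t} \<Longrightarrow> D w \<le> 0"
    and le: "p \<le> s" "s \<le> t" "t \<le> q"
  shows "f t \<le> f s"
proof (cases "s = t")
  case False
  show ?thesis
  proof (rule DERIV_nonpos_imp_decreasing_open[where f = f and a = s and b = t])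
    fix w assume w: "s < w" "w < t"
    hence "(f has_real_derivative D w) (at w)"
      using der[of w] le by (simp add: at_within_Icc_at)
    thus "\<exists>y. (f has_real_derivative y) (at w) \<and> y \<le> 0"
      using nonpos[of w] w by auto
  next
    have "continuous_on {p..q} f"
      using der by (intro DERIV_continuous_on)
    thus "continuous_on {s..t} f" by (rule continuous_on_subset) (use le in auto)
  qed (fact le)
qed auto

text \<open>
  A Lipschitz map sends the null set of exceptional times to a null set, so that some value strictly
  between \<open>h a\<close> and \<open>h b\<close> is attained at good times only. If \<open>h a < h b\<close>, the derivative at the last
  such time, after which \<open>h\<close> stays above that value, could not be negative.
\<close>

lemma lipschitz_AE_neg_deriv_le:
  fixes h :: "real \<Rightarrow> real"
  assumes lip: "L-lipschitz_on {a..b} h" and "a \<le> b"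
    and ae: "AE t in lebesgue_on {a..b}. \<exists>D<0. (h has_real_derivative D) (at t within {a..b})"
  shows "h b \<le> h a"
proof (rule ccontr)
  define N where "N = {t \<in> {a..b}. \<not> (\<exists>D<0. (h has_real_derivative D) (at t within {a..b}))}"
  assume "\<not> h b \<le> h a"
  hence less: "h a < h b" by simp
  have "negligible N"
    using ae unfolding AE_lebesgue_on_Icc_iff_negligible N_def .
  hence "negligible (h ` N)"
  proof (rule negligible_locally_Lipschitz_image[rotated])
    fix s assume "s \<in> N"
    thus "\<exists>T B. open T \<and> s \<in> T \<and> (\<forall>y\<in>N \<inter> T. norm (h y - h s) \<le> B * norm (y - s))"
      using lipschitz_on_normD[OF lip]
      by (intro exI[of _ UNIV] exI[of _ L]) (auto simp: N_def)
  qed simp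
  moreover have "\<not> negligible {h a<..<h b}"
    using less not_interval_UNIV open_not_negligible[of "{h a<..<h b}"] by auto
  ultimately have "\<not> {h a<..<h b} \<subseteq> h ` N"
    using negligible_subset by blast
  then obtain c where c: "h a < c" "c < h b" "c \<notin> h ` N"
    by force
  have cont: "continuous_on {a..b} h"
    using lip by (rule lipschitz_on_continuous_on)
  define K where "K = {t \<in> {a..b}. h t \<le> c}"
  have "K = {a..b} \<inter> h -` {..c}" by (auto simp: K_def)
  hence "closed K"
    using continuous_closed_preimage[OF cont, of "{..c}"] by simp
  moreover have "bounded K"
    by (rule bounded_subset[of "{a..b}"]) (auto simp: K_def)
  moreover have "a \<in> K" using c \<open>a \<le> b\<close> by (auto simp: K_def)
  ultimately obtain s where s: "s \<in> K" "\<And>t. t \<in> K \<Longrightarrow> t \<le> s"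
    using compact_attains_sup[of K] by (auto simp: compact_eq_bounded_closed)
  hence sab: "a \<le> s" "s \<le> b" "h s \<le> c" by (auto simp: K_def)
  have "s < b" using sab c by (cases "s = b") auto
  have above: "h t > c" if "t \<in> {s<..b}" for t
    using s(2)[of t] that sab by (force simp: K_def)
  have "h s = c"
  proof (rule ccontr)
    assume "h s \<noteq> c"
    hence "h s \<le> c" using sab by simp
    moreover have "continuous_on {s..b} h" using cont by (rule continuous_on_subset) (use sab in auto)
    ultimately obtain t where t: "s \<le> t" "t \<le> b" "h t = c"
      using IVT'[of h s c b] c \<open>s < b\<close> by auto
    with above[of t] \<open>h s \<noteq> c\<close> show False by (cases "t = s") auto
  qed
  hence "s \<notin> N" using c by auto
  then obtain D where "D < 0" "(h has_real_derivative D) (at s within {a..b})"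
    using sab by (auto simp: N_def)
  then obtain d where d: "d > 0" "\<And>e. 0 < e \<Longrightarrow> s + e \<in> {a..b} \<Longrightarrow> e < d \<Longrightarrow> h s > h (s + e)"
    using has_real_derivative_neg_dec_right by metis
  define e where "e = min (d / 2) (b - s)"
  have "0 < e" "e < d" "s + e \<in> {s<..b}"
    using d \<open>s < b\<close> by (auto simp: e_def min_def)
  with d(2)[of e] above[of "s + e"] sab \<open>h s = c\<close> show False by auto
qed

lemma lipschitz_AE_deriv_le:
  fixes f :: "real \<Rightarrow> real"
  assumes lip: "L-lipschitz_on {a..b} f" and ab: "a \<le> b"
    and ae: "AE t in lebesgue_on {a..b}. \<exists>D\<le>M. (f has_real_derivative D) (at t within {a..b})"
  shows "f b - f a \<le> M * (b - a)"
proof (rule field_le_epsilon)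
  fix e :: real assume e: "e > 0"
  define m where "m = M + e / (b - a + 1)"
  have m: "m > M" using e ab by (simp add: m_def)
  have "f b - m * b \<le> f a - m * a"
  proof (rule lipschitz_AE_neg_deriv_le[where h = "\<lambda>t. f t - m * t"])
    show "(L + \<bar>m\<bar>)-lipschitz_on {a..b} (\<lambda>t. f t - m * t)"
      by (intro lipschitz_on_diff lip lipschitz_onI)
        (auto simp: dist_real_def abs_mult simp flip: right_diff_distrib)
    show "AE t in lebesgue_on {a..b}.
            \<exists>D<0. ((\<lambda>t. f t - m * t) has_real_derivative D) (at t within {a..b})"
    proof (rule AE_lebesgue_on_Icc_subset[OF ae])
      fix t assume "\<exists>D\<le>M. (f has_real_derivative D) (at t within {a..b})"
      then obtain D where "D \<le> M" "(f has_real_derivative D) (at t within {a..b})" by blast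
      thus "\<exists>D<0. ((\<lambda>t. f t - m * t) has_real_derivative D) (at t within {a..b})"
        using m by (intro exI[of _ "D - m"]) (auto intro!: derivative_eq_intros)
    qed auto
  qed (fact ab)
  hence "f b - f a \<le> m * (b - a)" by (simp add: algebra_simps)
  also have "\<dots> = M * (b - a) + e * ((b - a) / (b - a + 1))"
    using ab by (simp add: m_def field_simps)
  also have "\<dots> \<le> M * (b - a) + e"
    using e ab by (simp add: divide_le_eq)
  finally show "f b - f a \<le> M * (b - a) + e" .
qed

section \<open>Admissible processes\<close>

text \<open>
  The bound \<open>\<bar>u\<bar> \<le> 1\<close> enters the comparison of trajectories only through this inequality.
\<close>

lemma free_admissible_velocity_lipschitz:
  assumes adm: "free_admissible P T x y u" and st: "0 \<le> s" "s \<le> t" "t \<le> T"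
  shows "\<bar>y t - y s\<bar> \<le> t - s"
proof -
  obtain L where lip: "L-lipschitz_on {0..T} y"
    using adm by (auto simp: free_admissible_def)
  define N where "N = {r \<in> {0..T}. \<not> \<bar>u r\<bar> \<le> 1} \<union>
    {r \<in> {0..T}. \<not> (y has_real_derivative u r) (at r within {0..T})}"
  have "negligible N"
    using adm by (simp add: free_admissible_def AE_lebesgue_on_Icc_iff_negligible N_def)
  have der: "\<bar>u r\<bar> \<le> 1 \<and> (y has_real_derivative u r) (at r within {s..t})"
    if "r \<in> {s..t}" "r \<notin> N" for r
  proof -
    have sub: "{s..t} \<subseteq> {0..T}" using st by auto
    with that have "\<bar>u r\<bar> \<le> 1" "(y has_real_derivative u r) (at r within {0..T})"
      by (auto simp: N_def)
    with DERIV_subset[OF _ sub] show ?thesis by blast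
  qed
  have bound: "c * y t - c * y s \<le> 1 * (t - s)" if c: "c = 1 \<or> c = -1" for c :: real
  proof (rule lipschitz_AE_deriv_le)
    show "L-lipschitz_on {s..t} (\<lambda>r. c * y r)"
      using lipschitz_on_subset[OF lip, of "{s..t}"] st c by auto
    show "AE r in lebesgue_on {s..t}.
            \<exists>D\<le>1. ((\<lambda>r. c * y r) has_real_derivative D) (at r within {s..t})"
      unfolding AE_lebesgue_on_Icc_iff_negligible
    proof (rule negligible_subset[OF \<open>negligible N\<close>], safe, rule ccontr)
      fix r assume r: "r \<in> {s..t}" "r \<notin> N"
        and no: "\<not> (\<exists>D\<le>1. ((\<lambda>r. c * y r) has_real_derivative D) (at r within {s..t}))"
      have "((\<lambda>r. c * y r) has_real_derivative c * u r) (at r within {s..t})"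
        using der[OF r] by (auto intro!: derivative_eq_intros)
      moreover have "c * u r \<le> 1" using der[OF r] c by auto
      ultimately show False using no by blast
    qed
  qed (use st in auto)
  from bound[of 1] bound[of "-1"] show ?thesis by auto
qed

lemma free_admissible_velocity_continuous:
  assumes "free_admissible P T x y u"
  shows "continuous_on {0..T} y"
  using assms by (auto simp: free_admissible_def intro: lipschitz_on_continuous_on)

text \<open>
  The equation for \<open>x\<close>, assumed almost everywhere, holds at every time because \<open>y\<close> is continuous.
\<close>

lemma free_admissible_position_deriv:
  assumes adm: "free_admissible P T x y u" and t: "t \<in> {0..T}"
  shows "(x has_real_derivative y t) (at t within {0..T})"
proof -
  define Y where "Y = (\<lambda>t. integral {0..t} y)"
  have cont: "continuous_on {0..T} y"
    by (rule free_admissible_velocity_continuous[OF adm])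
  have Y: "(Y has_real_derivative y t) (at t within {0..T})" if "t \<in> {0..T}" for t
    unfolding Y_def using cont that by (rule integral_has_real_derivative)
  obtain L where lip: "L-lipschitz_on {0..T} x"
    using adm by (auto simp: free_admissible_def)
  obtain B' where B': "\<And>v. v \<in> y ` {0..T} \<Longrightarrow> norm v \<le> B'"
    using compact_imp_bounded[OF compact_continuous_image[OF cont compact_Icc]]
    unfolding bounded_iff by blast
  define B where "B = max B' 0"
  have B: "B \<ge> 0" "\<And>t. t \<in> {0..T} \<Longrightarrow> \<bar>y t\<bar> \<le> B"
    using B' by (force simp: B_def)+
  have lipY: "B-lipschitz_on {0..T} Y"
  proof (rule bounded_derivative_imp_lipschitz)
    show "(Y has_derivative (*) (y t)) (at t within {0..T})" if "t \<in> {0..T}" for t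
      using Y[OF that] by (simp add: has_field_derivative_def)
    show "onorm ((*) (y t)) \<le> B" if "t \<in> {0..T}" for t
      using B that by (intro onorm_bound) (auto simp: abs_mult mult_right_mono)
  qed (use B in auto)
  have ae: "AE t in lebesgue_on {0..T}. (x has_real_derivative y t) (at t within {0..T})"
    using adm by (auto simp: free_admissible_def)
  have bound: "c * (x t - Y t) - c * (x 0 - Y 0) \<le> 0 * (t - 0)"
    if t: "t \<in> {0..T}" and c: "c = 1 \<or> c = -1" for t c :: real
  proof (rule lipschitz_AE_deriv_le)
    have "(L + B)-lipschitz_on {0..t} (\<lambda>r. x r - Y r)"
      using t by (intro lipschitz_on_diff lipschitz_on_subset[OF lip] lipschitz_on_subset[OF lipY]) auto
    thus "(L + B)-lipschitz_on {0..t} (\<lambda>r. c * (x r - Y r))"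
      using c lipschitz_on_minus_iff[of "L + B" "{0..t}" "\<lambda>r. x r - Y r"] by auto
    show "AE r in lebesgue_on {0..t}.
            \<exists>D\<le>0. ((\<lambda>r. c * (x r - Y r)) has_real_derivative D) (at r within {0..t})"
    proof (rule AE_lebesgue_on_Icc_subset[OF ae])
      fix r assume r: "r \<in> {0..t}" "(x has_real_derivative y r) (at r within {0..T})"
      have "((\<lambda>r. c * (x r - Y r)) has_real_derivative c * (y r - y r)) (at r within {0..T})"
        using r t by (intro DERIV_cmult DERIV_diff Y) auto
      hence "((\<lambda>r. c * (x r - Y r)) has_real_derivative 0) (at r within {0..t})"
        using t by (simp add: DERIV_subset[where s="{0..T}"])
      thus "\<exists>D\<le>0. ((\<lambda>r. c * (x r - Y r)) has_real_derivative D) (at r within {0..t})"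
        by blast
    qed (use t in auto)
  qed (use t in auto)
  have eq: "x 0 - Y 0 + Y t = x t" if "t \<in> {0..T}" for t
    using bound[OF that, of 1] bound[OF that, of "-1"] by auto
  have "((\<lambda>t. x 0 - Y 0 + Y t) has_real_derivative y t) (at t within {0..T})"
    using Y[OF t] by (auto intro!: derivative_eq_intros)
  thus ?thesis
    by (rule has_field_derivative_transform_within[OF _ zero_less_one t]) (rule eq)
qed

lemma free_admissible_control_AE_unique:
  assumes adm: "free_admissible P T x y u" and adm': "free_admissible P' T x' y' u'"
    and eq: "\<And>t. t \<in> {0..T} \<Longrightarrow> y t = y' t"
  shows "AE t in lebesgue_on {0..T}. u t = u' t"
proof -
  have neg: "negligible ({r \<in> {0..T}. \<not> (y has_real_derivative u r) (at r within {0..T})} \<union>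
      {r \<in> {0..T}. \<not> (y' has_real_derivative u' r) (at r within {0..T})} \<union> {0, T})"
    using adm adm' by (simp add: free_admissible_def AE_lebesgue_on_Icc_iff_negligible)
  show ?thesis
    unfolding AE_lebesgue_on_Icc_iff_negligible
  proof (rule negligible_subset[OF neg], intro subsetI, rule ccontr)
    fix t assume "t \<in> {t \<in> {0..T}. u t \<noteq> u' t}"
      and "t \<notin> {r \<in> {0..T}. \<not> (y has_real_derivative u r) (at r within {0..T})} \<union>
        {r \<in> {0..T}. \<not> (y' has_real_derivative u' r) (at r within {0..T})} \<union> {0, T}"
    hence t: "t \<in> {0..T}" "0 < t" "t < T" and neq: "u t \<noteq> u' t"
      and d: "(y has_real_derivative u t) (at t within {0..T})"
      and d': "(y' has_real_derivative u' t) (at t within {0..T})"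
      by auto
    have "(y has_real_derivative u' t) (at t within {0..T})"
      by (rule has_field_derivative_transform_within[OF d' zero_less_one t(1)]) (simp add: eq)
    with d have "u t = u' t"
      using t by (simp add: at_within_Icc_at DERIV_unique)
    with neq show False by simp
  qed
qed

lemma borel_measurable_lebesgue_on_Icc_AE_cong:
  fixes f g :: "real \<Rightarrow> real"
  assumes "f \<in> borel_measurable (lebesgue_on {a..b})" "AE t in lebesgue_on {a..b}. g t = f t"
  shows "g \<in> borel_measurable (lebesgue_on {a..b})"
proof -
  have "(\<lambda>t. if t \<in> {a..b} then f t else 0) \<in> borel_measurable lebesgue"
    using assms(1) by (subst borel_measurable_if) auto
  moreover have "AE t in lebesgue. t \<in> {a..b} \<longrightarrow> g t = f t"
    using assms(2) by (subst (asm) AE_restrict_space_iff) auto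
  hence "AE t in lebesgue. (if t \<in> {a..b} then f t else 0) = (if t \<in> {a..b} then g t else 0)"
    by eventually_elim auto
  ultimately have "(\<lambda>t. if t \<in> {a..b} then g t else 0) \<in> borel_measurable lebesgue"
    by (rule borel_measurable_AE)
  thus ?thesis by (subst (asm) borel_measurable_if) auto
qed

lemma free_admissible_cong:
  assumes adm: "free_admissible P T x' y' u'"
    and x: "\<And>t. t \<in> {0..T} \<Longrightarrow> x t = x' t" and y: "\<And>t. t \<in> {0..T} \<Longrightarrow> y t = y' t"
    and u: "AE t in lebesgue_on {0..T}. u t = u' t"
  shows "free_admissible P T x y u"
proof -
  note adm = adm[unfolded free_admissible_def]
  have T: "0 \<le> T" using adm by simp
  have x': "(x has_real_derivative D) (at t within {0..T})"
    if "(x' has_real_derivative D) (at t within {0..T})" "t \<in> {0..T}" for t D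
    by (rule has_field_derivative_transform_within[OF that(1) zero_less_one that(2)]) (simp add: x)
  have y': "(y has_real_derivative D) (at t within {0..T})"
    if "(y' has_real_derivative D) (at t within {0..T})" "t \<in> {0..T}" for t D
    by (rule has_field_derivative_transform_within[OF that(1) zero_less_one that(2)]) (simp add: y)
  have "AE t in lebesgue_on {0..T}. \<bar>u t\<bar> \<le> 1"
  proof (rule AE_lebesgue_on_Icc_subset)
    show "AE t in lebesgue_on {0..T}. \<bar>u' t\<bar> \<le> 1 \<and> u t = u' t"
      using adm u by simp
  qed simp_all
  moreover have "AE t in lebesgue_on {0..T}. (x has_real_derivative y t) (at t within {0..T})"
  proof (rule AE_lebesgue_on_Icc_subset)
    show "AE t in lebesgue_on {0..T}. (x' has_real_derivative y' t) (at t within {0..T})"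
      using adm by blast
  qed (simp_all add: y x')
  moreover have "AE t in lebesgue_on {0..T}. (y has_real_derivative u t) (at t within {0..T})"
  proof (rule AE_lebesgue_on_Icc_subset)
    show "AE t in lebesgue_on {0..T}. (y' has_real_derivative u' t) (at t within {0..T}) \<and> u t = u' t"
      using adm u by simp
  qed (simp_all add: y')
  moreover have "u \<in> borel_measurable (lebesgue_on {0..T})"
  proof (rule borel_measurable_lebesgue_on_Icc_AE_cong[OF _ u])
    show "u' \<in> borel_measurable (lebesgue_on {0..T})"
      using adm by blast
  qed
  moreover obtain Lx Ly where "Lx-lipschitz_on {0..T} x'" "Ly-lipschitz_on {0..T} y'"
    using adm by blast
  hence "Lx-lipschitz_on {0..T} x" and "Ly-lipschitz_on {0..T} y"
    by (auto intro: lipschitz_on_transform[OF _ x] lipschitz_on_transform[OF _ y])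
  hence "\<exists>L. L-lipschitz_on {0..T} x" and "\<exists>L. L-lipschitz_on {0..T} y"
    by blast+
  moreover have "(x 0, y 0) = P" "(x T, y T) = (0, 0)"
    using adm T x[of 0] x[of T] y[of 0] y[of T] by simp_all
  ultimately show ?thesis
    using T unfolding free_admissible_def by (intro conjI) (fact | assumption)+
qed

text \<open>
  The free problem is invariant under reflection in the origin.
\<close>

lemma free_admissible_uminus_iff:
  "free_admissible (x0, y0) T x y u \<longleftrightarrow>
   free_admissible (- x0, - y0) T (\<lambda>t. - x t) (\<lambda>t. - y t) (\<lambda>t. - u t)"
proof -
  have imp: "free_admissible (- x0, - y0) T (\<lambda>t. - x t) (\<lambda>t. - y t) (\<lambda>t. - u t)"
    if "free_admissible (x0, y0) T x y u" for x0 y0 x y u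
  proof -
    note adm = that[unfolded free_admissible_def]
    have "AE t in lebesgue_on {0..T}. (x has_real_derivative y t) (at t within {0..T})"
      and "AE t in lebesgue_on {0..T}. (y has_real_derivative u t) (at t within {0..T})"
      using adm by auto
    then have "AE t in lebesgue_on {0..T}. ((\<lambda>t. - x t) has_real_derivative - y t) (at t within {0..T})"
      and "AE t in lebesgue_on {0..T}. ((\<lambda>t. - y t) has_real_derivative - u t) (at t within {0..T})"
      by - (erule eventually_mono, erule DERIV_minus)+
    thus ?thesis using adm by (auto simp: free_admissible_def)
  qed
  show ?thesis
    using imp[of x0 y0 x y u] imp[of "- x0" "- y0" "\<lambda>t. - x t" "\<lambda>t. - y t" "\<lambda>t. - u t"] by auto
qed

section \<open>The reference curve\<close>

text \<open>
  \<open>(go_x k a W w, go_y k a W w)\<close> is the phase point from which the reference process reaches the origin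
  in time \<open>w\<close>; so \<open>w\<close> is the remaining time and the process started with remaining time \<open>T\<close> is at
  \<open>go_x k a W (T - t)\<close>, \<open>go_y k a W (T - t)\<close> at time \<open>t\<close>. The control, as a function of the remaining time,
  is \<open>+1\<close> on \<open>[0,a]\<close>, the feedback \<open>u = k y\<close> on \<open>(a,W]\<close> and \<open>-1\<close> beyond \<open>W\<close>. The middle leg lies on \<open>\<Gamma>\<close> exactly when
  the point with \<open>y = -a\<close> on the switching curve does. For \<open>W = a\<close> there is no middle leg, \<open>k\<close> plays no
  role, and the curve is a bang-bang trajectory of the free problem. Values at negative \<open>w\<close>
  are immaterial. Parametrising by remaining time makes the part with \<open>w \<le> W\<close> independent of \<open>W\<close>, so
  that tails of reference processes are reference processes.
\<close>

definition go_x :: "real \<Rightarrow> real \<Rightarrow> real \<Rightarrow> real \<Rightarrow> real" where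
  "go_x k a W w =
     (if w \<le> a then w\<^sup>2 / 2
      else if w \<le> W then a\<^sup>2 / 2 + a / k * (1 - exp (- k * (w - a)))
      else a\<^sup>2 / 2 + a / k * (1 - exp (- k * (W - a)))
             + a * exp (- k * (W - a)) * (w - W) - (w - W)\<^sup>2 / 2)"

text \<open>
The velocity along the reference curve; see \<^const>\<open>go_x\<close>.
\<close>

definition go_y :: "real \<Rightarrow> real \<Rightarrow> real \<Rightarrow> real \<Rightarrow> real" where
  "go_y k a W w =
     (if w \<le> a then - w
      else if w \<le> W then - a * exp (- k * (w - a))
      else w - W - a * exp (- k * (W - a)))"

text \<open>
The control along the reference curve; see \<^const>\<open>go_x\<close>.
\<close>

definition go_u :: "real \<Rightarrow> real \<Rightarrow> real \<Rightarrow> real \<Rightarrow> real" where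
  "go_u k a W w =
     (if w \<le> a then 1
      else if w \<le> W then - k * a * exp (- k * (w - a))
      else -1)"

lemma go_low:
  assumes "w \<le> a"
  shows "go_x k a W w = w\<^sup>2 / 2" "go_y k a W w = - w"
  using assms by (simp_all add: go_x_def go_y_def)

lemma go_mid:
  assumes "a \<le> w" "w \<le> W"
  shows "go_x k a W w = a\<^sup>2 / 2 + a / k * (1 - exp (- k * (w - a)))"
    and "go_y k a W w = - a * exp (- k * (w - a))"
  using assms by (cases "w = a"; simp add: go_x_def go_y_def)+

text \<open>
  Beyond \<open>W\<close> the curve follows a parabola \<open>x = - y\<^sup>2 / 2 + const\<close>.
\<close>

lemma go_high:
  assumes "a \<le> W" "W \<le> w"
  shows "go_x k a W w = go_x k a W W + (go_y k a W W)\<^sup>2 / 2 - (go_y k a W w)\<^sup>2 / 2"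
    and "go_y k a W w = go_y k a W W + (w - W)"
proof -
  show y: "go_y k a W w = go_y k a W W + (w - W)"
    using assms by (auto simp: go_y_def)
  have "go_x k a W w = go_x k a W W - go_y k a W W * (w - W) - (w - W)\<^sup>2 / 2"
    using assms by (cases "w = W"; cases "W = a") (auto simp: go_x_def go_y_def)
  thus "go_x k a W w = go_x k a W W + (go_y k a W W)\<^sup>2 / 2 - (go_y k a W w)\<^sup>2 / 2"
    by (simp add: y power2_eq_square field_simps)
qed

lemma go_x_deriv:
  assumes "k \<noteq> 0" "0 \<le> a" "a \<le> W" "W \<le> T" "w \<in> {0..T}"
  shows "(go_x k a W has_real_derivative - go_y k a W w) (at w within {0..T})"
proof -
  let ?m = "\<lambda>w. a\<^sup>2 / 2 + a / k * (1 - exp (- k * (w - a)))"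
  let ?h = "\<lambda>w. ?m W + a * exp (- k * (W - a)) * (w - W) - (w - W)\<^sup>2 / 2"
  let ?m' = "\<lambda>w. a * exp (- k * (w - a))"
  let ?h' = "\<lambda>w. a * exp (- k * (W - a)) - (w - W)"
  have inner: "((\<lambda>w. if w \<le> W then ?m w else ?h w) has_real_derivative
      (if w \<le> W then ?m' w else ?h' w)) (at w within {a..T})" if "w \<in> {a..T}" for w
    by (rule has_real_derivative_glue_Icc)
      (use that assms in \<open>auto intro!: derivative_eq_intros simp: field_simps\<close>)
  have "((\<lambda>w. if w \<le> a then w\<^sup>2 / 2 else if w \<le> W then ?m w else ?h w) has_real_derivative
      (if w \<le> a then w else if w \<le> W then ?m' w else ?h' w)) (at w within {0..T})"
    by (rule has_real_derivative_glue_Icc[OF _ inner])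
      (use assms in \<open>auto intro!: derivative_eq_intros\<close>)
  moreover have "(if w \<le> a then w else if w \<le> W then ?m' w else ?h' w) = - go_y k a W w"
    by (simp add: go_y_def)
  ultimately show ?thesis
    by (simp add: go_x_def[abs_def])
qed

lemma go_y_deriv:
  assumes "a \<le> W" "w \<noteq> a" "w \<noteq> W"
  shows "(go_y k a W has_real_derivative - go_u k a W w) (at w)"
proof -
  consider "w < a" | "a < w" "w < W" | "W < w" using assms by linarith
  thus ?thesis
  proof cases
    case 1
    have "((\<lambda>w. - w) has_real_derivative - go_u k a W w) (at w)"
      using 1 by (auto intro!: derivative_eq_intros simp: go_u_def)
    thus ?thesis
      by (rule has_field_derivative_transform_within_open[where S = "{..<a}"])
        (use 1 in \<open>auto simp: go_y_def\<close>)
  next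
    case 2
    have "((\<lambda>w. - a * exp (- k * (w - a))) has_real_derivative - go_u k a W w) (at w)"
      using 2 by (auto intro!: derivative_eq_intros simp: go_u_def)
    thus ?thesis
      by (rule has_field_derivative_transform_within_open[where S = "{a<..<W}"])
        (use 2 in \<open>auto simp: go_y_def\<close>)
  next
    case 3
    have "((\<lambda>w. w - W - a * exp (- k * (W - a))) has_real_derivative - go_u k a W w) (at w)"
      using 3 assms by (auto intro!: derivative_eq_intros simp: go_u_def)
    thus ?thesis
      by (rule has_field_derivative_transform_within_open[where S = "{W<..}"])
        (use 3 assms in \<open>auto simp: go_y_def\<close>)
  qed
qed

lemma go_u_abs_le:
  assumes "0 < k" "0 \<le> a" "k * a \<le> 1"
  shows "\<bar>go_u k a W w\<bar> \<le> 1"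
proof -
  have "\<bar>k * a * exp (- k * (w - a))\<bar> \<le> 1 * 1" if "a \<le> w"
    unfolding abs_mult using assms that by (intro mult_mono) (auto simp flip: abs_mult)
  thus ?thesis by (auto simp: go_u_def)
qed

lemma go_y_lipschitz:
  assumes "0 < k" "0 \<le> a" "k * a \<le> 1" "a \<le> W"
  shows "1-lipschitz_on {0..T} (go_y k a W)"
proof -
  have bnd: "onorm ((*) c) \<le> 1" if "\<bar>c\<bar> \<le> 1" for c :: real
    using that by (intro onorm_le) (auto simp: abs_mult mult_left_le_one_le)
  have mid: "1-lipschitz_on {a..W} (\<lambda>w. - a * exp (- k * (w - a)))"
  proof (rule bounded_derivative_imp_lipschitz)
    fix w assume w: "w \<in> {a..W}"
    show "((\<lambda>w. - a * exp (- k * (w - a))) has_derivative (*) (k * a * exp (- k * (w - a))))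
            (at w within {a..W})"
      unfolding has_field_derivative_def[symmetric] by (auto intro!: derivative_eq_intros)
    have "k * a * exp (- k * (w - a)) \<le> 1 * 1"
      using assms w by (intro mult_mono) auto
    thus "onorm ((*) (k * a * exp (- k * (w - a)))) \<le> 1"
      using assms by (intro bnd) auto
  qed auto
  have "1-lipschitz_on {0..max W T} (\<lambda>w. if w \<le> a then - w
      else (\<lambda>w. if w \<le> W then - a * exp (- k * (w - a)) else w - W - a * exp (- k * (W - a))) w)"
    by (intro lipschitz_on_concat mid) (use assms in \<open>auto intro!: lipschitz_onI simp: dist_real_def\<close>)
  hence "1-lipschitz_on {0..max W T} (go_y k a W)"
    by (simp add: go_y_def[abs_def])
  thus ?thesis by (rule lipschitz_on_subset) auto
qed

lemma free_admissible_go: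
  assumes k: "0 < k" and a: "0 \<le> a" "k * a \<le> 1" and le: "a \<le> W" "W \<le> T"
  shows "free_admissible (go_x k a W T, go_y k a W T) T
           (\<lambda>t. go_x k a W (T - t)) (\<lambda>t. go_y k a W (T - t)) (\<lambda>t. go_u k a W (T - t))"
proof -
  have T: "0 \<le> T" using a le by simp
  have x': "((\<lambda>t. go_x k a W (T - t)) has_real_derivative go_y k a W (T - t)) (at t within {0..T})"
    if t: "t \<in> {0..T}" for t
  proof -
    have "(go_x k a W has_real_derivative - go_y k a W (T - t)) (at (T - t) within {0..T})"
      using assms t by (intro go_x_deriv) auto
    from has_real_derivative_time_reversal[OF this] show ?thesis by simp
  qed
  have lipy: "1-lipschitz_on {0..T} (\<lambda>t. go_y k a W (T - t))"
  proof (rule lipschitz_onI)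
    fix s t assume "s \<in> {0..T}" "t \<in> {0..T}"
    thus "dist (go_y k a W (T - s)) (go_y k a W (T - t)) \<le> 1 * dist s t"
      using lipschitz_onD[OF go_y_lipschitz[OF k a le(1), of T], of "T - s" "T - t"]
      by (simp add: dist_real_def)
  qed simp
  have B: "\<bar>go_y k a W (T - t)\<bar> \<le> T" if "t \<in> {0..T}" for t
    using lipschitz_onD[OF go_y_lipschitz[OF k a le(1), of T], of "T - t" 0] go_low[of 0 a k W] a that
    by (auto simp: dist_real_def)
  have lipx: "T-lipschitz_on {0..T} (\<lambda>t. go_x k a W (T - t))"
  proof (rule bounded_derivative_imp_lipschitz)
    fix t assume t: "t \<in> {0..T}"
    show "((\<lambda>t. go_x k a W (T - t)) has_derivative (*) (go_y k a W (T - t))) (at t within {0..T})"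
      using x'[OF t] by (simp add: has_field_derivative_def)
    show "onorm ((*) (go_y k a W (T - t))) \<le> T"
      using B t by (intro onorm_le) (auto simp: abs_mult mult_right_mono)
  qed (use T in auto)
  have y': "((\<lambda>t. go_y k a W (T - t)) has_real_derivative go_u k a W (T - t)) (at t within {0..T})"
    if "t \<notin> {T - a, T - W}" for t
  proof -
    have "(go_y k a W has_real_derivative - go_u k a W (T - t)) (at (T - t))"
      using le that by (intro go_y_deriv) auto
    hence "((\<lambda>t. go_y k a W (T - t)) has_real_derivative - go_u k a W (T - t) * -1) (at t)"
      by (rule DERIV_chain2) (auto intro!: derivative_eq_intros)
    thus ?thesis by (simp add: has_field_derivative_at_within)
  qed
  have "(\<lambda>t. go_u k a W (T - t)) \<in> borel_measurable borel"
    unfolding go_u_def by measurable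
  hence "(\<lambda>t. go_u k a W (T - t)) \<in> borel_measurable (lebesgue_on {0..T})"
    by (intro measurable_restrict_space1 measurable_completion) simp
  moreover have "AE t in lebesgue_on {0..T}.
      ((\<lambda>t. go_y k a W (T - t)) has_real_derivative go_u k a W (T - t)) (at t within {0..T})"
    by (rule AE_lebesgue_on_Icc_finite[of "{T - a, T - W}"]) (use y' in auto)
  moreover have "AE t in lebesgue_on {0..T}.
      ((\<lambda>t. go_x k a W (T - t)) has_real_derivative go_y k a W (T - t)) (at t within {0..T})"
    by (rule AE_lebesgue_on_Icc_finite[of "{}"]) (use x' in auto)
  moreover have "go_x k a W (T - T) = 0" "go_y k a W (T - T) = 0"
    using a by (simp_all add: go_low)
  ultimately show ?thesis
    unfolding free_admissible_def using T go_u_abs_le[OF k a] lipx lipy by auto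
qed

section \<open>Comparison with the reference curve\<close>

text \<open>
  The core of the optimality argument. Time runs backward from the origin. With \<open>\<delta> = \<xi> - X\<close>, the
  hypotheses say that \<open>\<delta>\<close> is nonincreasing on \<open>[0,a]\<close> and on \<open>[W,T]\<close>, and that \<open>exp (k w) * \<delta> w\<close> is
  nonincreasing on \<open>[a,W]\<close>. As \<open>\<delta>\<close> vanishes at both ends of \<open>[0,T]\<close>, it is at most \<open>0\<close> at \<open>a\<close>, at least
  \<open>0\<close> at \<open>W\<close>, and therefore \<open>0\<close> throughout.
\<close>

lemma backward_comparison:
  fixes X Y \<xi> \<eta> :: "real \<Rightarrow> real"
  assumes le: "0 \<le> a" "a \<le> W" "W \<le> T"
    and X: "\<And>w. w \<in> {0..T} \<Longrightarrow> (X has_real_derivative - Y w) (at w within {0..T})"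
    and \<xi>: "\<And>w. w \<in> {0..T} \<Longrightarrow> (\<xi> has_real_derivative - \<eta> w) (at w within {0..T})"
    and ends: "\<xi> 0 = X 0" "\<xi> T = X T"
    and first: "\<And>w. w \<in> {0..a} \<Longrightarrow> Y w \<le> \<eta> w"
    and last: "\<And>w. w \<in> {W..T} \<Longrightarrow> Y w \<le> \<eta> w"
    and mid: "\<And>w. a < W \<Longrightarrow> w \<in> {a..W} \<Longrightarrow> k * (\<xi> w - X w) \<le> \<eta> w - Y w"
    and w: "w \<in> {0..T}"
  shows "\<xi> w = X w"
proof -
  define \<delta> where "\<delta> = (\<lambda>w. \<xi> w - X w)"
  define \<epsilon> where "\<epsilon> = (\<lambda>w. exp (k * w) * \<delta> w)"
  have d\<delta>: "(\<delta> has_real_derivative Y w - \<eta> w) (at w within {0..T})" if "w \<in> {0..T}" for w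
    unfolding \<delta>_def using DERIV_diff[OF \<xi>[OF that] X[OF that]] by simp
  have d\<epsilon>: "(\<epsilon> has_real_derivative exp (k * w) * (k * \<delta> w + (Y w - \<eta> w))) (at w within {0..T})"
    if "w \<in> {0..T}" for w
    unfolding \<epsilon>_def by (rule derivative_eq_intros d\<delta>[OF that] refl | simp add: algebra_simps)+
  have A: "\<delta> t \<le> \<delta> s" if "0 \<le> s" "s \<le> t" "t \<le> a" for s t
    by (rule nonincreasing_if_deriv_nonpos_Icc[OF d\<delta>]) (use that first le in \<open>auto simp: field_simps\<close>)
  have B: "\<epsilon> t \<le> \<epsilon> s" if "a \<le> s" "s \<le> t" "t \<le> W" for s t
  proof (cases "a < W")
    case True
    show ?thesis
    proof (rule nonincreasing_if_deriv_nonpos_Icc[where f = \<epsilon> and p = 0 and q = T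
          and D = "\<lambda>w. exp (k * w) * (k * \<delta> w + (Y w - \<eta> w))"])
      show "exp (k * w) * (k * \<delta> w + (Y w - \<eta> w)) \<le> 0" if "w \<in> {s..t}" for w
        using mid[OF True, of w] that \<open>a \<le> s\<close> \<open>t \<le> W\<close>
        by (intro mult_nonneg_nonpos) (auto simp: \<delta>_def)
    qed (use that le d\<epsilon> in auto)
  next
    case False
    with that le have "s = t" by auto
    thus ?thesis by simp
  qed
  have C: "\<delta> t \<le> \<delta> s" if "W \<le> s" "s \<le> t" "t \<le> T" for s t
    by (rule nonincreasing_if_deriv_nonpos_Icc[OF d\<delta>]) (use that last le in \<open>auto simp: field_simps\<close>)
  have \<epsilon>_le: "\<epsilon> s \<le> 0 \<longleftrightarrow> \<delta> s \<le> 0" and \<epsilon>_ge: "0 \<le> \<epsilon> s \<longleftrightarrow> 0 \<le> \<delta> s" for s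
    by (simp_all add: \<epsilon>_def mult_le_0_iff zero_le_mult_iff not_le)
  have ends': "\<delta> 0 = 0" "\<delta> T = 0" using ends by (simp_all add: \<delta>_def)
  have "\<delta> a \<le> 0" using A[of 0 a] ends' le by simp
  moreover have "0 \<le> \<delta> W" using C[of W T] ends' le by simp
  moreover have "\<epsilon> W \<le> \<epsilon> a" using B[of a W] le by simp
  ultimately have \<epsilon>0: "\<epsilon> a = 0" "\<epsilon> W = 0"
    using \<epsilon>_le[of a] \<epsilon>_ge[of W] by linarith+
  hence \<delta>0: "\<delta> a = 0" "\<delta> W = 0" by (auto simp: \<epsilon>_def)
  consider "w \<le> a" | "a \<le> w" "w \<le> W" | "W \<le> w" by linarith
  hence "\<delta> w = 0"
  proof cases
    case 1
    thus ?thesis using A[of 0 w] A[of w a] ends' \<delta>0 w by simp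
  next
    case 2
    thus ?thesis using B[of a w] B[of w W] \<epsilon>0 \<epsilon>_le[of w] \<epsilon>_ge[of w] by simp
  next
    case 3
    thus ?thesis using C[of W w] C[of w T] ends' \<delta>0 w by simp
  qed
  thus ?thesis by (simp add: \<delta>_def)
qed

text \<open>
  No process is faster than the reference process, and none of the same duration differs from it in
  position or velocity. The state constraint of the competitor, and the condition that the middle
  leg lies on \<open>\<Gamma>\<close>, are needed only if that leg is present.
\<close>

lemma go_uniquely_fastest:
  assumes adm: "free_admissible (go_x k a W T, go_y k a W T) T' x y u" and T': "T' \<le> T"
    and k: "0 < k" and a: "0 < a" and le: "a \<le> W" "W \<le> T"
    and constr: "a < W \<Longrightarrow> 0 \<le> b \<and> k * a\<^sup>2 / 2 - b = - a \<and> (\<forall>t\<in>{0..T'}. k * x t - b \<le> y t)"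
  shows "T' = T \<and> (\<forall>t\<in>{0..T}. x t = go_x k a W (T - t) \<and> y t = go_y k a W (T - t))"
proof -
  have T'0: "0 \<le> T'" and x0: "x 0 = go_x k a W T" and y0: "y 0 = go_y k a W T"
    and xT: "x T' = 0" and yT: "y T' = 0"
    using adm by (auto simp: free_admissible_def)
  note ylip = free_admissible_velocity_lipschitz[OF adm]
  \<comment> \<open>A faster competitor is prolonged by resting at the origin up to time \<open>T\<close>.\<close>
  define xe where "xe = (\<lambda>t. if t \<le> T' then x t else 0)"
  define ye where "ye = (\<lambda>t. if t \<le> T' then y t else 0)"
  have xe': "(xe has_real_derivative ye t) (at t within {0..T})" if "t \<in> {0..T}" for t
    unfolding xe_def ye_def
    by (rule has_real_derivative_glue_Icc)
      (use that T' T'0 xT yT free_admissible_position_deriv[OF adm] in auto)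
  have \<xi>': "((\<lambda>w. xe (T - w)) has_real_derivative - ye (T - w)) (at w within {0..T})"
    if w: "w \<in> {0..T}" for w
    by (rule has_real_derivative_time_reversal) (use w xe' in auto)
  have X': "(go_x k a W has_real_derivative - go_y k a W w) (at w within {0..T})"
    if "w \<in> {0..T}" for w
    using k a le that by (intro go_x_deriv) auto
  have eqx: "xe (T - w) = go_x k a W w" if "w \<in> {0..T}" for w
  proof (rule backward_comparison[where k = k and X = "go_x k a W" and Y = "go_y k a W"
        and \<xi> = "\<lambda>w. xe (T - w)" and \<eta> = "\<lambda>w. ye (T - w)", OF _ le X' \<xi>' _ _ _ _ _ that])
    show "xe (T - 0) = go_x k a W 0"
      using T' xT a by (auto simp: xe_def go_low)
    show "xe (T - T) = go_x k a W T"
      using T'0 x0 by (simp add: xe_def)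
    show "go_y k a W w \<le> ye (T - w)" if "w \<in> {0..a}" for w
      using ylip[of "T - w" T'] yT that T' le by (auto simp: ye_def go_low)
    show "go_y k a W w \<le> ye (T - w)" if "w \<in> {W..T}" for w
    proof -
      have "go_y k a W w = y 0 - (T - w)"
        using go_high(2)[of a W w k] go_high(2)[of a W T k] le that y0 by auto
      thus ?thesis
        using ylip[of 0 "T - w"] ylip[of 0 T'] yT that T' T'0 by (auto simp: ye_def)
    qed
    show "k * (xe (T - w) - go_x k a W w) \<le> ye (T - w) - go_y k a W w"
      if "a < W" "w \<in> {a..W}" for w
    proof -
      have b: "0 \<le> b" "k * a\<^sup>2 / 2 - b = - a" and c: "\<And>t. t \<in> {0..T'} \<Longrightarrow> k * x t - b \<le> y t"
        using constr[OF \<open>a < W\<close>] by auto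
      have "go_y k a W w = k * go_x k a W w - b"
        using go_mid[of a w W k] that b k by (auto simp: field_simps)
      moreover have "k * xe (T - w) - b \<le> ye (T - w)"
        using b(1) c[of "T - w"] that le by (auto simp: xe_def ye_def)
      ultimately show ?thesis by (simp add: algebra_simps)
    qed
  qed (use a in auto)
  have eqy: "ye (T - w) = go_y k a W w" if w: "w \<in> {0..T}" for w
  proof -
    have "((\<lambda>w. xe (T - w)) has_real_derivative - go_y k a W w) (at w within {0..T})"
      by (rule has_field_derivative_transform_within[OF X'[OF w] zero_less_one w]) (simp add: eqx)
    moreover have "at w within {0..T} \<noteq> bot"
      using w a le by (simp add: trivial_limit_within islimpt_Icc)
    ultimately have "- ye (T - w) = - go_y k a W w"
      using \<xi>'[OF w] vector_derivative_unique_within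
      unfolding has_real_derivative_iff_has_vector_derivative by blast
    thus ?thesis by simp
  qed
  have "T' = T"
  proof (rule ccontr)
    assume "T' \<noteq> T"
    \<comment> \<open>Otherwise the competitor would rest at the origin while the reference curve moves with \<open>u = 1\<close>.\<close>
    define w where "w = min a (T - T') / 2"
    have w: "0 < w" "w \<le> a" "w < T - T'"
      using a T' \<open>T' \<noteq> T\<close> by (auto simp: w_def min_def)
    hence "go_y k a W w = 0"
      using eqy[of w] T'0 by (auto simp: ye_def)
    with w show False by (simp add: go_low)
  qed
  moreover have "x t = go_x k a W (T - t) \<and> y t = go_y k a W (T - t)" if "t \<in> {0..T}" for t
    using eqx[of "T - t"] eqy[of "T - t"] that \<open>T' = T\<close> by (auto simp: xe_def ye_def)
  ultimately show ?thesis by blast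
qed

section \<open>Phase-plane geometry\<close>

text \<open>
  In terms of \<open>a = - y_A k b\<close>: the point with \<open>y = -a\<close> on the switching curve lies on \<open>\<Gamma>\<close>, and \<open>C\<close> lies
  below \<open>A\<close> exactly when \<open>k a < 1\<close>. The latter makes the feedback \<open>u = k y\<close> feasible on \<open>[A,E]\<close> and forces
  the parabolas of \<open>u = -1\<close> to cross \<open>\<Gamma>\<close> transversally there.
\<close>

lemma y_A_facts:
  assumes "0 < k" "0 < b" "snd (pt_C k b) < snd (pt_A k b)"
  shows "0 < - y_A k b" "k * (- y_A k b)\<^sup>2 / 2 - b = - (- y_A k b)" "k * - y_A k b < 1"
proof -
  define r where "r = sqrt (2 * b * k + 1)"
  have r: "1 < r" "r\<^sup>2 = 2 * b * k + 1"
    using assms by (auto simp: r_def)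
  have y: "y_A k b = (1 - r) / k" by (simp add: y_A_def r_def)
  show "0 < - y_A k b" using r assms by (simp add: y divide_neg_pos)
  have "k * (- y_A k b)\<^sup>2 / 2 = (1 - 2 * r + r\<^sup>2) / (2 * k)"
    using assms by (simp add: y power2_eq_square field_simps)
  also have "\<dots> = b - - y_A k b"
    using assms by (simp add: r(2) y field_simps)
  finally show "k * (- y_A k b)\<^sup>2 / 2 - b = - (- y_A k b)" by linarith
  have "- (1 / k) < y_A k b" using assms by (simp add: pt_C_def pt_A_def)
  thus "k * - y_A k b < 1" using assms by (simp add: field_simps)
qed

text \<open>
  Along a parabola \<open>x = c - y\<^sup>2 / 2\<close> the quantity \<open>k x - y\<close>, which the state constraint bounds by \<open>b\<close>, decreases
  in \<open>y\<close> as long as \<open>y > -1/k\<close>, that is, above the point of tangency with the direction of \<open>\<Gamma>\<close>.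
\<close>

lemma slack_strict_antimono_on_arc:
  fixes k a c :: real
  assumes "0 < k" "k * a < 1" "- a \<le> y0" "y0 < y1"
  shows "k * (c - y1\<^sup>2 / 2) - y1 < k * (c - y0\<^sup>2 / 2) - y0"
proof -
  have "k * - y0 \<le> k * a" "k * - y1 \<le> k * a" using assms by (intro mult_left_mono; simp)+
  hence "- 2 < k * (y0 + y1)"
    using \<open>k * a < 1\<close> by (simp add: distrib_left)
  hence "0 < k * (y0 + y1) / 2 + 1"
    by simp
  hence "0 < (y1 - y0) * (k * (y0 + y1) / 2 + 1)"
    using assms by (intro mult_pos_pos) auto
  also have "\<dots> = (k * (c - y0\<^sup>2 / 2) - y0) - (k * (c - y1\<^sup>2 / 2) - y1)"
    by (simp add: power2_eq_square algebra_simps add_divide_distrib diff_divide_distrib)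
  finally show ?thesis by simp
qed

lemma slack_on_final_arc:
  fixes k a b w :: real
  assumes "0 < k" "k * a\<^sup>2 / 2 - b = - a" "0 \<le> w" "w < a"
  shows "k * (w\<^sup>2 / 2) - b < - w"
proof -
  have "w\<^sup>2 \<le> a\<^sup>2" using assms by (intro power_mono) auto
  hence "k * w\<^sup>2 \<le> k * a\<^sup>2" using assms by (intro mult_left_mono) auto
  hence "k * w\<^sup>2 / 2 - b < - w" using assms by linarith
  thus ?thesis by simp
qed

lemma mem_open_segment_A_E:
  assumes k: "0 < k" and a: "a = - y_A k b" "0 < a" "k * a\<^sup>2 / 2 - b = - a"
  shows "(x, y) \<in> open_segment (pt_A k b) (pt_E k b) \<longleftrightarrow> - a < y \<and> y < 0 \<and> y = k * x - b"
proof -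
  have A: "pt_A k b = ((b - a) / k, - a)"
    using k a by (simp add: pt_A_def field_simps)
  have ne: "pt_A k b \<noteq> pt_E k b" using a by (simp add: A pt_E_def)
  show ?thesis
  proof
    assume "(x, y) \<in> open_segment (pt_A k b) (pt_E k b)"
    then obtain v where v: "0 < v" "v < 1" "(x, y) = (1 - v) *\<^sub>R pt_A k b + v *\<^sub>R pt_E k b"
      by (auto simp: in_segment)
    hence x: "x = (1 - v) * ((b - a) / k) + v * (b / k)" and y: "y = - ((1 - v) * a)"
      by (auto simp: A pt_E_def)
    have "k * x = (1 - v) * (b - a) + v * b"
      using k by (simp add: x field_simps)
    thus "- a < y \<and> y < 0 \<and> y = k * x - b"
      using v a(2) by (auto simp: y algebra_simps)
  next
    assume R: "- a < y \<and> y < 0 \<and> y = k * x - b"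
    define v where "v = 1 + y / a"
    have v: "0 < v" "v < 1" using R a(2) by (auto simp: v_def field_simps)
    have "x = (y + b) / k" using R k by (simp add: field_simps)
    hence "(x, y) = (1 - v) *\<^sub>R pt_A k b + v *\<^sub>R pt_E k b"
      using k a(2) by (auto simp: A pt_E_def v_def field_simps)
    thus "(x, y) \<in> open_segment (pt_A k b) (pt_E k b)"
      using v ne by (auto simp: in_segment)
  qed
qed

lemma go_on_Gamma:
  assumes "0 < k" "k * a\<^sup>2 / 2 - b = - a" "a \<le> w" "w \<le> W"
  shows "k * go_x k a W w - b = go_y k a W w"
  using assms by (simp add: go_mid field_simps)

lemma go_mem_open_segment:
  assumes k: "0 < k" and a: "a = - y_A k b" "0 < a" "k * a\<^sup>2 / 2 - b = - a"
    and w: "a < w" "w \<le> W"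
  shows "(go_x k a W w, go_y k a W w) \<in> open_segment (pt_A k b) (pt_E k b)"
proof -
  have "exp (- k * (w - a)) < 1" using k w by simp
  hence "- a < go_y k a W w" "go_y k a W w < 0"
    using w a(2) by (auto simp: go_mid)
  thus ?thesis
    using go_on_Gamma[of k a b w W] k a w by (subst mem_open_segment_A_E[OF k a]) auto
qed

text \<open>
  Inverting \<open>y = - a exp (- k (W - a))\<close> yields the remaining time \<open>W\<close> at a given point of the segment.
\<close>

lemma open_segment_go:
  assumes k: "0 < k" and a: "a = - y_A k b" "0 < a" "k * a\<^sup>2 / 2 - b = - a"
    and P: "P \<in> open_segment (pt_A k b) (pt_E k b)"
  obtains W where "a < W" "P = (go_x k a W W, go_y k a W W)"
proof -
  obtain x y where xy: "P = (x, y)" by (cases P)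
  with P have y: "- a < y" "y < 0" "y = k * x - b"
    using mem_open_segment_A_E[OF k a] by auto
  \<comment> \<open>The solution of \<open>- a * exp (- k * (W - a)) = y\<close>.\<close>
  define W where "W = a + ln (a / - y) / k"
  have W: "a < W" using y k by (simp add: W_def)
  have "exp (- k * (W - a)) = exp (- ln (a / - y))" using k by (simp add: W_def)
  also have "\<dots> = inverse (a / - y)"
    using y(2) a(2) by (simp only: exp_minus exp_ln divide_pos_pos neg_0_less_iff_less)
  also have "\<dots> = - y / a" by simp
  finally have gy: "go_y k a W W = y" using W a by (simp add: go_mid)
  have "k * go_x k a W W - b = k * x - b"
    using go_on_Gamma[of k a b W W] k a W y gy by simp
  hence "go_x k a W W = x" using k by simp
  with that[OF W] gy xy show ?thesis by simp
qed

lemma go_slack_pos: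
  assumes "0 < k" "k * a < 1" "0 < a" "k * a\<^sup>2 / 2 - b = - a" "a \<le> W" "W < w"
  shows "k * go_x k a W w - b < go_y k a W w"
proof -
  have "- a \<le> go_y k a W W"
    using assms by (simp add: go_mid)
  moreover have "go_y k a W W < go_y k a W w"
    using go_high(2)[of a W w k] assms by simp
  ultimately have "k * (go_x k a W W + (go_y k a W W)\<^sup>2 / 2 - (go_y k a W w)\<^sup>2 / 2) - go_y k a W w
      < k * (go_x k a W W + (go_y k a W W)\<^sup>2 / 2 - (go_y k a W W)\<^sup>2 / 2) - go_y k a W W"
    using assms by (intro slack_strict_antimono_on_arc[of k a]) auto
  also have "\<dots> = b" using go_on_Gamma[of k a b W W] assms by simp
  finally show ?thesis using go_high(1)[of a W w k] assms by simp
qed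

lemma go_constraint:
  assumes "0 < k" "k * a < 1" "0 < a" "k * a\<^sup>2 / 2 - b = - a" "a \<le> W" "0 \<le> w"
  shows "k * go_x k a W w - b \<le> go_y k a W w"
proof -
  consider "w < a" | "a \<le> w" "w \<le> W" | "W < w" by linarith
  thus ?thesis
  proof cases
    case 1
    thus ?thesis using slack_on_final_arc[of k a b w] assms by (simp add: go_low)
  next
    case 2
    thus ?thesis using go_on_Gamma[of k a b w W] assms by simp
  next
    case 3
    thus ?thesis using go_slack_pos[of k a b W w] assms by simp
  qed
qed

section \<open>Optimal processes from points of the reference curve\<close>

text \<open>
  Complete description of the optimal processes from a point of the reference curve: the reference
  process on \<open>[0,T]\<close>, up to changes of the control on a null set.
\<close>

lemma optimal_go_iff:
  assumes k: "0 < k" and b: "0 < b" and a: "0 < a" "k * a < 1" "k * a\<^sup>2 / 2 - b = - a"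
    and W: "a \<le> W" "W \<le> T"
  shows "optimal k b (go_x k a W T, go_y k a W T) T' x y u \<longleftrightarrow>
     T' = T \<and> (\<forall>t\<in>{0..T}. x t = go_x k a W (T - t) \<and> y t = go_y k a W (T - t)) \<and>
     (AE t in lebesgue_on {0..T}. u t = go_u k a W (T - t))"
    (is "optimal k b ?P T' x y u \<longleftrightarrow> ?R")
proof -
  have ref: "free_admissible ?P T (\<lambda>t. go_x k a W (T - t)) (\<lambda>t. go_y k a W (T - t))
      (\<lambda>t. go_u k a W (T - t))"
    by (rule free_admissible_go) (use k a W in auto)
  have constr: "k * go_x k a W (T - t) - b \<le> go_y k a W (T - t)" if "t \<in> {0..T}" for t
    by (rule go_constraint) (use k a W that in auto)
  have uniq: "T'' = T \<and> (\<forall>t\<in>{0..T}. x t = go_x k a W (T - t) \<and> y t = go_y k a W (T - t))"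
    if "admissible k b ?P T'' x y u" "T'' \<le> T" for T'' x y u
    by (rule go_uniquely_fastest[where b = b]) (use that k a b W in \<open>auto simp: admissible_def\<close>)
  show ?thesis
  proof
    assume opt: "optimal k b ?P T' x y u"
    have "T' \<le> T"
      using opt ref constr unfolding optimal_def admissible_def by blast
    with opt uniq[of T' x y u] have T': "T' = T"
      and eq: "\<forall>t\<in>{0..T}. x t = go_x k a W (T - t) \<and> y t = go_y k a W (T - t)"
      by (auto simp: optimal_def)
    have "free_admissible ?P T x y u"
      using opt T' by (simp add: optimal_def admissible_def)
    hence "AE t in lebesgue_on {0..T}. u t = go_u k a W (T - t)"
      by (rule free_admissible_control_AE_unique[OF _ ref]) (use eq in auto)
    with T' eq show ?R by blast
  next
    assume R: ?R
    hence "free_admissible ?P T x y u"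
      by (intro free_admissible_cong[OF ref]) auto
    hence "admissible k b ?P T' x y u"
      using R constr by (auto simp: admissible_def)
    moreover have "T' \<le> T''" if "admissible k b ?P T'' x'' y'' u''" for T'' x'' y'' u''
      using uniq[OF that] R by linarith
    ultimately show "optimal k b ?P T' x y u"
      unfolding optimal_def by blast
  qed
qed

text \<open>
  The parabola of \<open>u = -1\<close> through a point of the interior of \<open>Q2\<close> meets the open segment \<open>(A,E)\<close>.
\<close>

lemma interior_Q2_go:
  assumes k: "0 < k" and a: "a = - y_A k b" "0 < a" "k * a < 1" "k * a\<^sup>2 / 2 - b = - a"
    and P: "P \<in> interior (Q2 k b)"
  obtains W T where "a < W" "W < T" "P = (go_x k a W T, go_y k a W T)"
proof -
  obtain x y where xy: "P = (x, y)" by (cases P)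
  obtain e where e: "e > 0" "ball (x, y) e \<subseteq> Q2 k b"
    using P xy by (auto simp: mem_interior)
  \<comment> \<open>Horizontal shifts of the point remain in \<open>Q2\<close>, which makes the inequalities for \<open>x\<close> strict.\<close>
  have "(x + e / 2, y) \<in> Q2 k b" "(x - e / 2, y) \<in> Q2 k b"
    using e by (auto intro!: subsetD[OF e(2)] simp: dist_Pair_Pair dist_real_def)
  hence y: "- a \<le> y" and lo: "a\<^sup>2 < x + y\<^sup>2 / 2" and hi1: "0 \<le> y \<Longrightarrow> x < b / k - y\<^sup>2 / 2"
    and hi2: "y \<le> 0 \<Longrightarrow> x < (y + b) / k"
    using e(1) a(1) by (auto simp: Q2_def)
  define c where "c = x + y\<^sup>2 / 2"
  \<comment> \<open>The value of \<open>k x - y\<close> at height \<open>v\<close> on the parabola; \<open>\<Gamma>\<close> is met where it equals \<open>b\<close>.\<close>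
  let ?f = "\<lambda>v. k * (c - v\<^sup>2 / 2) - v"
  have dec: "?f v1 < ?f v0" if "- a \<le> v0" "v0 < v1" for v0 v1
    using slack_strict_antimono_on_arc[OF k a(3) that] .
  have fy: "?f y < b" if "y \<le> 0"
    using hi2[OF that] k by (simp add: c_def field_simps)
  have "?f 0 < b"
  proof (cases "0 \<le> y")
    case True
    thus ?thesis using hi1 k by (simp add: c_def field_simps)
  next
    case False
    thus ?thesis using fy dec[of y 0] y by simp
  qed
  moreover have "b < ?f (- a)"
  proof -
    have "k * a\<^sup>2 < k * c" using lo k by (simp add: c_def)
    thus ?thesis using a(4) by (simp add: algebra_simps)
  qed
  moreover have "continuous_on {- a..0} ?f" by (intro continuous_intros) auto
  ultimately obtain v where v: "- a \<le> v" "v \<le> 0" "?f v = b"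
    using IVT2'[of ?f 0 b "- a"] a by auto
  have "v \<noteq> 0" "v \<noteq> - a" using v(3) \<open>?f 0 < b\<close> \<open>b < ?f (- a)\<close> by auto
  with v have v': "- a < v" "v < 0" by auto
  have "v < y"
  proof (rule ccontr)
    assume "\<not> v < y"
    hence "?f v \<le> ?f y" using dec[of y v] y by (cases "v = y") auto
    with fy \<open>\<not> v < y\<close> v v' show False by simp
  qed
  have "(c - v\<^sup>2 / 2, v) \<in> open_segment (pt_A k b) (pt_E k b)"
    using v v' by (subst mem_open_segment_A_E[OF k a(1,2,4)]) auto
  then obtain W where W: "a < W" "(c - v\<^sup>2 / 2, v) = (go_x k a W W, go_y k a W W)"
    by (rule open_segment_go[OF k a(1,2,4)])
  show ?thesis
  proof
    show "a < W" by (fact W(1))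
    show "W < W + (y - v)" using \<open>v < y\<close> by simp
    show "P = (go_x k a W (W + (y - v)), go_y k a W (W + (y - v)))"
    proof -
      have "go_x k a W W = c - v\<^sup>2 / 2" "go_y k a W W = v" using W(2)[symmetric] by simp_all
      thus ?thesis
        using W(1) go_high[of a W "W + (y - v)" k] \<open>v < y\<close> by (simp add: xy c_def)
    qed
  qed
qed

lemma go_mem_interior_Q2:
  assumes k: "0 < k" and a: "a = - y_A k b" "0 < a" "k * a < 1" "k * a\<^sup>2 / 2 - b = - a"
    and W: "a < W" "W < T" and neg: "go_y k a W T < 0"
  shows "(go_x k a W T, go_y k a W T) \<in> interior (Q2 k b)"
proof -
  define U where "U = {p :: real \<times> real. - a < snd p \<and> snd p < 0 \<and>
      a\<^sup>2 - (snd p)\<^sup>2 / 2 < fst p \<and> fst p < (snd p + b) / k}"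
  have "open U"
    unfolding U_def by (intro open_Collect_conj open_Collect_less continuous_intros) (use k in auto)
  moreover have "U \<subseteq> Q2 k b"
    by (auto simp: U_def Q2_def a(1))
  moreover have "(go_x k a W T, go_y k a W T) \<in> U"
  proof -
    have seg: "- a < go_y k a W W" "go_y k a W W = k * go_x k a W W - b"
      using go_mem_open_segment[of k a b W W] k a W mem_open_segment_A_E[of k a b] by auto
    have "- a < go_y k a W T"
      using seg go_high(2)[of a W T k] W by simp
    moreover have "go_x k a W T < (go_y k a W T + b) / k"
      using go_slack_pos[of k a b W T] k a W by (simp add: field_simps)
    moreover have "a\<^sup>2 < go_x k a W W + (go_y k a W W)\<^sup>2 / 2"
    proof -
      let ?c = "go_x k a W W + (go_y k a W W)\<^sup>2 / 2"
      have "b = k * (?c - (go_y k a W W)\<^sup>2 / 2) - go_y k a W W" using seg by simp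
      also have "\<dots> < k * (?c - (- a)\<^sup>2 / 2) - - a"
        using k a seg by (intro slack_strict_antimono_on_arc[of k a]) auto
      finally have "k * a\<^sup>2 < k * ?c" using a(4) by (simp add: algebra_simps)
      thus ?thesis using k by simp
    qed
    ultimately show ?thesis
      using neg go_high(1)[of a W T k] W by (simp add: U_def)
  qed
  ultimately show ?thesis by (meson interiorI)
qed

section \<open>Free optimal processes from Q1\<close>

lemma go_bang_bang:
  assumes "0 \<le> a" "a \<le> w"
  shows "go_x k a a w = a\<^sup>2 - (go_y k a a w)\<^sup>2 / 2" "go_y k a a w = w - 2 * a"
  using go_high[of a a w k] go_low[of a a k a] assms by simp_all

text \<open>
  Without a middle leg the first argument of the curve is irrelevant; the value \<open>1 / a\<close> meets the
  requirement \<open>k a \<le> 1\<close> for an admissible control.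
\<close>

lemma free_go_uniquely_fastest:
  assumes a: "0 < a" "a \<le> T"
    and adm: "free_admissible (go_x (1 / a) a a T, go_y (1 / a) a a T) T' x y u" "T' \<le> T"
  shows "T' = T \<and> (\<forall>t\<in>{0..T}. x t = go_x (1 / a) a a (T - t) \<and> y t = go_y (1 / a) a a (T - t))"
  by (rule go_uniquely_fastest[OF adm, where b = 0]) (use a in auto)

text \<open>
  A point strictly to the right of the switching curve or on its lower branch, the origin excluded,
  is on a curve with \<open>u = -1\<close> up to the lower branch of the switching curve and \<open>u = 1\<close> from there.
\<close>

lemma right_point_go:
  fixes x y :: real
  assumes "0 < x + y\<^sup>2 / 2" "0 \<le> y \<or> y\<^sup>2 / 2 \<le> x"
  obtains a T where "0 < a" "a \<le> T" "a\<^sup>2 = x + y\<^sup>2 / 2" "T = 2 * a + y"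
    "go_x (1 / a) a a T = x" "go_y (1 / a) a a T = y"
proof -
  define a where "a = sqrt (x + y\<^sup>2 / 2)"
  have a: "0 < a" "a\<^sup>2 = x + y\<^sup>2 / 2" using assms(1) by (simp_all add: a_def)
  have "- y \<le> a"
  proof (cases "0 \<le> y")
    case False
    hence "(- y)\<^sup>2 \<le> a\<^sup>2" using assms(2) a(2) by simp
    thus ?thesis by (rule power2_le_imp_le) (use a(1) in simp)
  qed (use a(1) in simp)
  hence le: "a \<le> 2 * a + y" by simp
  have gy: "go_y (1 / a) a a (2 * a + y) = y"
    using go_bang_bang(2)[OF less_imp_le[OF a(1)] le] by simp
  moreover have "go_x (1 / a) a a (2 * a + y) = x"
    using go_bang_bang(1)[OF less_imp_le[OF a(1)] le] by (simp add: gy a(2))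
  ultimately show ?thesis using that[OF a(1) le a(2)] by blast
qed

text \<open>
  From a point of \<open>Q1\<close> to the right of the switching curve, the free trajectory switches at or above the
  height of \<open>A\<close>, and its first arc lies to the left of the parabola through \<open>A\<close>.
\<close>

lemma Q1_right_constraint:
  assumes k: "0 < k" and a: "a = - y_A k b" "0 < a" "k * a < 1" "k * a\<^sup>2 / 2 - b = - a"
    and P: "(x, y) \<in> Q1 k b" and right: "0 \<le> y \<or> y\<^sup>2 / 2 \<le> x"
    and c: "0 < c" "c \<le> T" "c\<^sup>2 = x + y\<^sup>2 / 2" "T = 2 * c + y"
    and w: "0 \<le> w" "w \<le> T"
  shows "k * go_x m c c w - b \<le> go_y m c c w"
proof -
  have in_strip: "k * x - b \<le> y" and in_Q1: "- a \<le> y \<Longrightarrow> x \<le> a\<^sup>2 - y\<^sup>2 / 2"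
    using P a(1) by (auto simp: Q1_def)
  \<comment> \<open>Below the height of \<open>A\<close> the constraint keeps the point to the left of the switching curve.\<close>
  have ya: "- a \<le> y"
  proof (rule ccontr)
    assume "\<not> - a \<le> y"
    hence lt: "a < - y" by simp
    with right a(2) have "y\<^sup>2 / 2 \<le> x" by auto
    hence "k * (y\<^sup>2 / 2) \<le> k * x" using k by simp
    moreover have "a\<^sup>2 < (- y)\<^sup>2" using lt a by (intro power_strict_mono) auto
    hence "k * a\<^sup>2 < k * y\<^sup>2" using k by simp
    ultimately show False using in_strip a lt by simp
  qed
  hence "c\<^sup>2 \<le> a\<^sup>2" using in_Q1 c by simp
  hence ca: "c \<le> a" by (rule power2_le_imp_le) (use a in simp)
  show ?thesis
  proof (cases "w < c")
    case True
    thus ?thesis using slack_on_final_arc[of k a b w] k a ca w by (simp add: go_low)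
  next
    case False
    hence g: "go_x m c c w = c\<^sup>2 - (go_y m c c w)\<^sup>2 / 2" "go_y m c c w = w - 2 * c"
      using go_bang_bang[of c w m] c by auto
    define v where "v = go_y m c c w"
    have v: "- a \<le> v" using g(2) False ca by (simp add: v_def)
    have "k * (a\<^sup>2 - v\<^sup>2 / 2) - v \<le> k * (a\<^sup>2 - (- a)\<^sup>2 / 2) - - a"
    proof (cases "v = - a")
      case False
      with v show ?thesis
        using slack_strict_antimono_on_arc[of k a "- a" v "a\<^sup>2"] k a by simp
    qed simp
    also have "\<dots> = b" using a(4) by (simp add: algebra_simps)
    finally have "k * (a\<^sup>2 - v\<^sup>2 / 2) - v \<le> b" .
    moreover have "k * (c\<^sup>2 - v\<^sup>2 / 2) \<le> k * (a\<^sup>2 - v\<^sup>2 / 2)"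
      using \<open>c\<^sup>2 \<le> a\<^sup>2\<close> k by (intro mult_left_mono) auto
    ultimately have "k * (c\<^sup>2 - v\<^sup>2 / 2) - b \<le> v" by linarith
    thus ?thesis by (simp only: g(1) v_def)
  qed
qed

text \<open>
  From a point to the left of the switching curve, the first arc has \<open>u = 1\<close>, and \<open>k x - b - y\<close> is a
  convex function of \<open>y\<close> on it that is nonpositive at both ends.
\<close>

lemma Q1_left_constraint:
  assumes k: "0 < k" and b: "0 < b" and P: "(x, y) \<in> Q1 k b"
    and c: "0 < c" "c \<le> T" "c\<^sup>2 = - x + y\<^sup>2 / 2" "T = 2 * c - y"
    and w: "0 \<le> w" "w \<le> T"
  shows "k * - go_x m c c w - b \<le> - go_y m c c w"
proof (cases "w < c")
  case True
  have "- (k * (w\<^sup>2 / 2)) \<le> 0" using k by simp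
  thus ?thesis using True w b by (simp add: go_low)
next
  case False
  hence g: "go_x m c c w = c\<^sup>2 - (go_y m c c w)\<^sup>2 / 2" "go_y m c c w = w - 2 * c"
    using go_bang_bang[of c w m] c by auto
  define v where "v = - go_y m c c w"
  have v: "y \<le> v" "v \<le> c" using g(2) False w c by (auto simp: v_def)
  define f where "f = (\<lambda>v. k * (v\<^sup>2 / 2 - c\<^sup>2) - b - v)"
  have fy: "f y \<le> 0"
  proof -
    have "f y = k * x - b - y" using c(3) by (simp add: f_def)
    thus ?thesis using P by (simp add: Q1_def)
  qed
  have "k * (c\<^sup>2 / 2 - c\<^sup>2) \<le> 0" using k by (simp add: mult_nonneg_nonpos)
  hence fc: "f c \<le> 0" using b c by (simp add: f_def)
  have "f v \<le> 0"
  proof (cases "y = c")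
    case True
    thus ?thesis using fc v by simp
  next
    case False
    hence "0 < c - y" using v by simp
    \<comment> \<open>Interpolation between the end values, with the convexity defect as last summand.\<close>
    have "(c - y) * f v = (c - v) * f y + (v - y) * f c + (c - y) * (k / 2 * ((v - y) * (v - c)))"
      by (simp add: f_def power2_eq_square field_simps)
    moreover have "(c - v) * f y \<le> 0" "(v - y) * f c \<le> 0"
      using v fy fc by (simp_all add: mult_nonneg_nonpos)
    moreover have "(c - y) * (k / 2 * ((v - y) * (v - c))) \<le> 0"
      using v k \<open>0 < c - y\<close> by (intro mult_nonneg_nonpos[of "c - y"] mult_nonneg_nonpos[of "k / 2"]
        mult_nonneg_nonpos[of "v - y"]) auto
    ultimately have "(c - y) * f v \<le> 0" by linarith
    thus ?thesis using \<open>0 < c - y\<close> by (simp add: mult_le_0_iff)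
  qed
  moreover have "- go_x m c c w = v\<^sup>2 / 2 - c\<^sup>2" by (simp add: g(1) v_def)
  ultimately show ?thesis by (simp only: f_def) (simp add: v_def)
qed

text \<open>
  From every point of \<open>Q1\<close> the unique free optimal trajectory respects the state constraint.
\<close>

lemma Q1_reference:
  assumes k: "0 < k" and b: "0 < b" and a: "a = - y_A k b" "0 < a" "k * a < 1" "k * a\<^sup>2 / 2 - b = - a"
    and P: "P \<in> Q1 k b"
  obtains T xr yr ur where "admissible k b P T xr yr ur"
    and "\<And>T' x y u. free_admissible P T' x y u \<Longrightarrow> T' \<le> T \<Longrightarrow>
           T' = T \<and> (\<forall>t\<in>{0..T}. x t = xr t \<and> y t = yr t)"
proof -
  obtain x0 y0 where xy: "P = (x0, y0)" by (cases P)
  \<comment> \<open>The origin, the points to the right of the switching curve, and their reflections.\<close>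
  consider "x0 = 0" "y0 = 0"
    | "0 < x0 + y0\<^sup>2 / 2" "0 \<le> y0 \<or> y0\<^sup>2 / 2 \<le> x0"
    | "0 < - x0 + (- y0)\<^sup>2 / 2" "0 \<le> - y0 \<or> (- y0)\<^sup>2 / 2 \<le> - x0"
  proof -
    show thesis
    proof (cases "y0 = 0")
      case True
      consider "x0 = 0" | "0 < x0" | "x0 < 0" by linarith
      thus ?thesis using that \<open>y0 = 0\<close> by cases simp_all
    next
      case False
      hence pos: "0 < y0\<^sup>2" by simp
      have neg: "(- y0)\<^sup>2 = y0\<^sup>2" by simp
      consider "0 < y0" "0 < x0 + y0\<^sup>2 / 2" | "0 < y0" "x0 + y0\<^sup>2 / 2 \<le> 0"
        | "y0 < 0" "y0\<^sup>2 / 2 \<le> x0" | "y0 < 0" "x0 < y0\<^sup>2 / 2"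
        using False by linarith
      thus ?thesis
      proof cases
        case 1
        thus ?thesis using that(2) by simp
      next
        case 2
        thus ?thesis using pos by (intro that(3); unfold neg; linarith)
      next
        case 3
        thus ?thesis using pos by (intro that(2); linarith)
      next
        case 4
        thus ?thesis by (intro that(3); unfold neg; linarith)
      qed
    qed
  qed
  thus ?thesis
  proof cases
    case 1
    have "free_admissible (0, 0) 0 (\<lambda>_. 0) (\<lambda>_. 0) (\<lambda>_. 0)"
      unfolding free_admissible_def by (auto intro!: exI[of _ 0] lipschitz_on_constant)
    hence "admissible k b P 0 (\<lambda>_. 0) (\<lambda>_. 0) (\<lambda>_. 0)"
      using 1 b by (simp add: admissible_def xy)
    moreover have "T' = 0 \<and> (\<forall>t\<in>{0..0}. x t = 0 \<and> y t = 0)"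
      if "free_admissible P T' x y u" "T' \<le> 0" for T' x y u
      using that 1 by (auto simp: free_admissible_def xy)
    ultimately show ?thesis by (rule that)
  next
    case 2
    then obtain c T where c: "0 < c" "c \<le> T" "c\<^sup>2 = x0 + y0\<^sup>2 / 2" "T = 2 * c + y0"
      "go_x (1 / c) c c T = x0" "go_y (1 / c) c c T = y0"
      by (rule right_point_go)
    have "free_admissible P T (\<lambda>t. go_x (1 / c) c c (T - t)) (\<lambda>t. go_y (1 / c) c c (T - t))
        (\<lambda>t. go_u (1 / c) c c (T - t))"
      using free_admissible_go[of "1 / c" c c T] c by (simp add: xy)
    moreover have "k * go_x (1 / c) c c (T - t) - b \<le> go_y (1 / c) c c (T - t)" if "t \<in> {0..T}" for t
      using Q1_right_constraint[OF k a P[unfolded xy] 2(2) c(1-4)] that by simp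
    ultimately have "admissible k b P T (\<lambda>t. go_x (1 / c) c c (T - t))
        (\<lambda>t. go_y (1 / c) c c (T - t)) (\<lambda>t. go_u (1 / c) c c (T - t))"
      by (simp add: admissible_def)
    moreover have "T' = T \<and> (\<forall>t\<in>{0..T}. x t = go_x (1 / c) c c (T - t) \<and> y t = go_y (1 / c) c c (T - t))"
      if "free_admissible P T' x y u" "T' \<le> T" for T' x y u
      using free_go_uniquely_fastest[OF c(1,2), of T' x y u] that c(5,6) xy by simp
    ultimately show ?thesis by (rule that)
  next
    case 3
    then obtain c T where c: "0 < c" "c \<le> T" "c\<^sup>2 = - x0 + (- y0)\<^sup>2 / 2" "T = 2 * c + - y0"
      "go_x (1 / c) c c T = - x0" "go_y (1 / c) c c T = - y0"
      by (rule right_point_go)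
    have "free_admissible (- x0, - y0) T (\<lambda>t. go_x (1 / c) c c (T - t))
        (\<lambda>t. go_y (1 / c) c c (T - t)) (\<lambda>t. go_u (1 / c) c c (T - t))"
      using free_admissible_go[of "1 / c" c c T] c by simp
    from iffD1[OF free_admissible_uminus_iff this]
    have "free_admissible P T (\<lambda>t. - go_x (1 / c) c c (T - t)) (\<lambda>t. - go_y (1 / c) c c (T - t))
        (\<lambda>t. - go_u (1 / c) c c (T - t))"
      by (simp add: xy)
    moreover have "k * - go_x (1 / c) c c (T - t) - b \<le> - go_y (1 / c) c c (T - t)"
      if "t \<in> {0..T}" for t
      using Q1_left_constraint[OF k b P[unfolded xy], of c T] c(1-4) that by simp
    ultimately have "admissible k b P T (\<lambda>t. - go_x (1 / c) c c (T - t))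
        (\<lambda>t. - go_y (1 / c) c c (T - t)) (\<lambda>t. - go_u (1 / c) c c (T - t))"
      by (simp add: admissible_def)
    moreover have "T' = T \<and> (\<forall>t\<in>{0..T}. x t = - go_x (1 / c) c c (T - t) \<and> y t = - go_y (1 / c) c c (T - t))"
      if adm: "free_admissible P T' x y u" "T' \<le> T" for T' x y u
    proof -
      have "free_admissible (- x0, - y0) T' (\<lambda>t. - x t) (\<lambda>t. - y t) (\<lambda>t. - u t)"
        by (rule iffD1[OF free_admissible_uminus_iff adm(1)[unfolded xy]])
      hence *: "T' = T \<and> (\<forall>t\<in>{0..T}. - x t = go_x (1 / c) c c (T - t) \<and> - y t = go_y (1 / c) c c (T - t))"
        unfolding c(5,6)[symmetric] by (rule free_go_uniquely_fastest[OF c(1,2) _ adm(2)])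
      hence "x t = - go_x (1 / c) c c (T - t) \<and> y t = - go_y (1 / c) c c (T - t)" if "t \<in> {0..T}" for t
        using bspec[OF conjunct2[OF *] that] by linarith
      with * show ?thesis by blast
    qed
    ultimately show ?thesis by (rule that)
  qed
qed

lemma Q1_optimal_iff_free_optimal:
  assumes "0 < k" "0 < b" "a = - y_A k b" "0 < a" "k * a < 1" "k * a\<^sup>2 / 2 - b = - a"
    and P: "P \<in> Q1 k b"
  shows "optimal k b P T x y u \<longleftrightarrow> free_optimal P T x y u" and "\<exists>T x y u. optimal k b P T x y u"
proof -
  obtain Tr xr yr ur where ref: "admissible k b P Tr xr yr ur"
    and uniq: "\<And>T' x y u. free_admissible P T' x y u \<Longrightarrow> T' \<le> Tr \<Longrightarrow>
           T' = Tr \<and> (\<forall>t\<in>{0..Tr}. x t = xr t \<and> y t = yr t)"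
    using Q1_reference[OF assms] by blast
  have free_le: "Tr \<le> T'" if "free_admissible P T' x y u" for T' x y u
    using uniq[OF that] by linarith
  have constr: "admissible k b P T' x y u" if adm: "free_admissible P T' x y u" "T' \<le> Tr" for T' x y u
    using uniq[OF adm] adm(1) ref by (auto simp: admissible_def)
  show "optimal k b P T x y u \<longleftrightarrow> free_optimal P T x y u"
  proof
    assume "optimal k b P T x y u"
    hence "free_admissible P T x y u" "T \<le> Tr"
      using ref unfolding optimal_def admissible_def by blast+
    thus "free_optimal P T x y u"
      using free_le by (force simp: free_optimal_def)
  next
    assume opt: "free_optimal P T x y u"
    have "T \<le> Tr" using opt ref unfolding free_optimal_def admissible_def by blast
    hence "admissible k b P T x y u"
      using constr opt by (auto simp: free_optimal_def)
    thus "optimal k b P T x y u"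
      using opt by (auto simp: optimal_def free_optimal_def admissible_def)
  qed
  show "\<exists>T x y u. optimal k b P T x y u"
  proof (intro exI)
    show "optimal k b P Tr xr yr ur"
      unfolding optimal_def using ref free_le by (intro conjI allI impI) (auto simp: admissible_def)
  qed
qed

section \<open>The optimal synthesis\<close>

lemma go_type_NNAO:
  assumes k: "0 < k" and a: "a = - y_A k b" "0 < a" "k * a < 1" "k * a\<^sup>2 / 2 - b = - a"
    and W: "a < W" "W < T"
    and xy: "\<forall>t\<in>{0..T}. x t = go_x k a W (T - t) \<and> y t = go_y k a W (T - t)"
    and u: "AE t in lebesgue_on {0..T}. u t = go_u k a W (T - t)"
  shows "first_leg k b (T - W) x y u" "type_NNAO k b T x y u"
proof -
  have "AE t in lebesgue_on {0..T - W}. u t = -1"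
    by (rule AE_lebesgue_on_Icc_subset_finite[OF u, where F = "{T - W}"])
      (use a W in \<open>auto simp: go_u_def\<close>)
  moreover have "x (T - W) = go_x k a W W" "y (T - W) = go_y k a W W"
    using xy a W by auto
  ultimately show leg: "first_leg k b (T - W) x y u"
    unfolding first_leg_def using W go_mem_open_segment[OF k a(1,2,4) W(1), of W] by simp
  have "AE t in lebesgue_on {T - W..T - a}. u t = k * y t"
  proof (rule AE_lebesgue_on_Icc_subset_finite[OF u, where F = "{T - a}"])
    fix t assume t: "t \<in> {T - W..T - a}" "t \<notin> {T - a}" "u t = go_u k a W (T - t)"
    moreover have "y t = go_y k a W (T - t)" using xy t W a by auto
    ultimately show "u t = k * y t"
      using W a by (auto simp: go_u_def go_mid)
  qed (use W a in auto)
  moreover have "AE t in lebesgue_on {T - a..T}. u t = 1"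
    by (rule AE_lebesgue_on_Icc_subset_finite[OF u, where F = "{}"])
      (use a W in \<open>auto simp: go_u_def\<close>)
  moreover have "(x t, y t) \<in> Gamma_line k b" if "t \<in> {T - W..T - a}" for t
  proof -
    have "x t = go_x k a W (T - t)" "y t = go_y k a W (T - t)" using xy that a W by auto
    thus ?thesis
      using go_on_Gamma[of k a b "T - t" W] k a that by (simp add: Gamma_line_def)
  qed
  moreover have "(x (T - a), y (T - a)) = pt_A k b"
    using xy a W by (simp add: pt_A_def go_low)
  ultimately show "type_NNAO k b T x y u"
    unfolding type_NNAO_def using leg W a
    by (intro exI[of _ "T - W"] exI[of _ "T - a"]) auto
qed

lemma go_restrict:
  assumes "a \<le> W'" "W' \<le> W" "w \<le> W'"
  shows "go_x k a W w = go_x k a W' w" "go_y k a W w = go_y k a W' w" "go_u k a W w = go_u k a W' w"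
  using assms by (auto simp: go_x_def go_y_def go_u_def)

text \<open>
  A process from a point of the segment is prolonged backward along a parabola of \<open>u = -1\<close>; conversely, a
  point of the segment can be met only on the middle leg, because the curve is strictly inside the
  constraint before that leg, and after it only \<open>A\<close> lies on \<open>\<Gamma>\<close>.
\<close>

lemma segment_optimal_iff_tail:
  assumes k: "0 < k" and b: "0 < b"
    and a: "a = - y_A k b" "0 < a" "k * a < 1" "k * a\<^sup>2 / 2 - b = - a"
    and P: "P \<in> open_segment (pt_A k b) (pt_E k b)"
  shows "optimal k b P T x y u \<longleftrightarrow>
        (\<exists>P' \<in> interior (Q2 k b). \<exists>T' x' y' u' t1 s.
            optimal k b P' T' x' y' u' \<and>
            first_leg k b t1 x' y' u' \<and> t1 \<le> s \<and>
            (x' s, y' s) = P \<and>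
            is_tail s T x y u T' x' y' u')"
    (is "_ \<longleftrightarrow> ?R")
proof
  obtain W where W: "a < W" "P = (go_x k a W W, go_y k a W W)"
    by (rule open_segment_go[OF k a(1,2,4) P])
  assume "optimal k b P T x y u"
  hence T: "T = W" and xy: "\<forall>t\<in>{0..W}. x t = go_x k a W (W - t) \<and> y t = go_y k a W (W - t)"
    and u: "AE t in lebesgue_on {0..W}. u t = go_u k a W (W - t)"
    using optimal_go_iff[OF k b a(2-4), of W W] W by auto
  have neg: "go_y k a W W < 0"
    using W(1) a(2) by (simp add: go_mid)
  \<comment> \<open>Half of the way up to the axis \<open>y = 0\<close>, so that the prolonged process starts inside \<open>Q2\<close>.\<close>
  define s where "s = - go_y k a W W / 2"
  have s: "0 < s" using neg by (simp add: s_def)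
  let ?x = "\<lambda>t. go_x k a W (W + s - t)" and ?y = "\<lambda>t. go_y k a W (W + s - t)"
    and ?u = "\<lambda>t. go_u k a W (W + s - t)" and ?P = "(go_x k a W (W + s), go_y k a W (W + s))"
  have "go_y k a W (W + s) < 0"
    using go_high(2)[of a W "W + s" k] W s neg by (simp add: s_def)
  hence int: "?P \<in> interior (Q2 k b)"
    using W s by (intro go_mem_interior_Q2[OF k a]) auto
  moreover have "optimal k b ?P (W + s) ?x ?y ?u"
    using optimal_go_iff[OF k b a(2-4), of W "W + s"] W s by simp
  moreover have "first_leg k b s ?x ?y ?u"
    using go_type_NNAO(1)[OF k a W(1), of "W + s" ?x ?y ?u] s by simp
  moreover have "is_tail s T x y u (W + s) ?x ?y ?u"
    using s W a T xy u by (simp add: is_tail_def)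
  moreover have "(?x s, ?y s) = P" using W by simp
  ultimately show ?R by blast
next
  assume ?R
  then obtain P' T' x' y' u' t1 s where P': "P' \<in> interior (Q2 k b)"
    and opt: "optimal k b P' T' x' y' u'" and Ps: "(x' s, y' s) = P"
    and tail: "is_tail s T x y u T' x' y' u'"
    by blast
  obtain W T0 where W: "a < W" "W < T0" "P' = (go_x k a W T0, go_y k a W T0)"
    by (rule interior_Q2_go[OF k a P'])
  have T': "T' = T0" and xy: "\<And>t. t \<in> {0..T'} \<Longrightarrow> x' t = go_x k a W (T' - t) \<and> y' t = go_y k a W (T' - t)"
    and u: "AE t in lebesgue_on {0..T'}. u' t = go_u k a W (T' - t)"
    using opt optimal_go_iff[OF k b a(2-4), of W T0] W by auto
  have s: "0 \<le> s" "s \<le> T'" "T = T' - s"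
    and xyt: "\<forall>t\<in>{0..T}. x t = x' (s + t) \<and> y t = y' (s + t)"
    and ut: "AE t in lebesgue_on {0..T}. u t = u' (s + t)"
    using tail by (auto simp: is_tail_def)
  have PT: "P = (go_x k a W T, go_y k a W T)"
    using Ps xy[of s] s by auto
  have seg: "- a < go_y k a W T" "go_y k a W T = k * go_x k a W T - b"
    using P mem_open_segment_A_E[OF k a(1,2,4)] by (auto simp: PT)
  have "a < T"
  proof (rule ccontr)
    assume "\<not> a < T"
    with seg have "T < a" "k * (T\<^sup>2 / 2) - b = - T" by (auto simp: go_low)
    thus False using slack_on_final_arc[OF k a(4), of T] s by simp
  qed
  moreover have "T \<le> W"
    using go_slack_pos[OF k a(3,2,4), of W T] seg W by (cases "T \<le> W") auto
  ultimately have res: "go_x k a W w = go_x k a T w" "go_y k a W w = go_y k a T w"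
    "go_u k a W w = go_u k a T w" if "w \<le> T" for w
    using go_restrict[of a T W w k] that by auto
  have eq: "T' - (s + t) = T - t" for t using s(3) by simp
  have "AE t in lebesgue_on {0..T}. u' (s + t) = go_u k a W (T' - (s + t))"
    unfolding s(3) by (rule AE_lebesgue_on_Icc_shift[OF u s(1)])
  with ut have "AE t in lebesgue_on {0..T}. u t = u' (s + t) \<and> u' (s + t) = go_u k a W (T' - (s + t))"
    by simp
  hence "AE t in lebesgue_on {0..T}. u t = go_u k a T (T - t)"
    by (rule AE_lebesgue_on_Icc_subset) (use res in \<open>auto simp: eq\<close>)
  moreover have "x t = go_x k a T (T - t) \<and> y t = go_y k a T (T - t)" if t: "t \<in> {0..T}" for t
  proof -
    have "x' (s + t) = go_x k a W (T - t) \<and> y' (s + t) = go_y k a W (T - t)"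
      using xy[of "s + t"] t s(1,3) unfolding eq by simp
    thus ?thesis using xyt t res[of "T - t"] by simp
  qed
  ultimately have "optimal k b (go_x k a T T, go_y k a T T) T x y u"
    using optimal_go_iff[OF k b a(2-4), of T T T x y u] \<open>a < T\<close> by simp
  thus "optimal k b P T x y u"
    by (simp add: PT res)
qed

theorem theorem3:
  fixes k b :: real
  assumes "k > 0" and "b > 0"
    and "snd (pt_C k b) < snd (pt_A k b)"
  shows
    "(\<forall>P \<in> Q1 k b \<union> interior (Q2 k b) \<union> open_segment (pt_A k b) (pt_E k b).
        \<exists>T x y u. optimal k b P T x y u) \<and>
     (\<forall>P \<in> Q1 k b. \<forall>T x y u.
        optimal k b P T x y u \<longleftrightarrow> free_optimal P T x y u) \<and>
     (\<forall>P \<in> interior (Q2 k b). \<forall>T x y u.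
        optimal k b P T x y u \<longrightarrow> type_NNAO k b T x y u) \<and>
     (\<forall>P \<in> open_segment (pt_A k b) (pt_E k b). \<forall>T x y u.
        optimal k b P T x y u \<longleftrightarrow>
        (\<exists>P' \<in> interior (Q2 k b). \<exists>T' x' y' u' t1 s.
            optimal k b P' T' x' y' u' \<and>
            first_leg k b t1 x' y' u' \<and> t1 \<le> s \<and>
            (x' s, y' s) = P \<and>
            is_tail s T x y u T' x' y' u'))"
proof (intro conjI ballI allI impI)
  define a where "a = - y_A k b"
  note k = \<open>k > 0\<close> and b = \<open>b > 0\<close>
  have a: "a = - y_A k b" "0 < a" "k * a < 1" "k * a\<^sup>2 / 2 - b = - a"
    using y_A_facts[OF assms] by (simp_all add: a_def)
  have ex: "\<exists>T' x y u. optimal k b (go_x k a W T, go_y k a W T) T' x y u" if "a \<le> W" "W \<le> T" for W T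
    using optimal_go_iff[OF k b a(2-4) that, of T "\<lambda>t. go_x k a W (T - t)" "\<lambda>t. go_y k a W (T - t)"
        "\<lambda>t. go_u k a W (T - t)"] by auto
  show "\<exists>T x y u. optimal k b P T x y u"
    if P: "P \<in> Q1 k b \<union> interior (Q2 k b) \<union> open_segment (pt_A k b) (pt_E k b)" for P
  proof -
    consider "P \<in> Q1 k b" | "P \<in> interior (Q2 k b)" | "P \<in> open_segment (pt_A k b) (pt_E k b)"
      using P by blast
    thus ?thesis
    proof cases
      case 1
      thus ?thesis by (rule Q1_optimal_iff_free_optimal(2)[OF k b a])
    next
      case 2
      then obtain W T where "a < W" "W < T" "P = (go_x k a W T, go_y k a W T)"
        by (rule interior_Q2_go[OF k a])
      thus ?thesis using ex[of W T] by simp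
    next
      case 3
      then obtain W where "a < W" "P = (go_x k a W W, go_y k a W W)"
        by (rule open_segment_go[OF k a(1,2,4)])
      thus ?thesis using ex[of W W] by simp
    qed
  qed
  show "optimal k b P T x y u \<longleftrightarrow> free_optimal P T x y u" if "P \<in> Q1 k b" for P T x y u
    by (rule Q1_optimal_iff_free_optimal(1)[OF k b a that])
  show "type_NNAO k b T x y u" if P: "P \<in> interior (Q2 k b)" and opt: "optimal k b P T x y u" for P T x y u
  proof -
    obtain W T0 where W: "a < W" "W < T0" "P = (go_x k a W T0, go_y k a W T0)"
      by (rule interior_Q2_go[OF k a P])
    have "T = T0" "\<forall>t\<in>{0..T0}. x t = go_x k a W (T0 - t) \<and> y t = go_y k a W (T0 - t)"
      "AE t in lebesgue_on {0..T0}. u t = go_u k a W (T0 - t)"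
      using opt optimal_go_iff[OF k b a(2-4), of W T0 T x y u] W by auto
    thus ?thesis using go_type_NNAO(2)[OF k a W(1,2)] by simp
  qed
  show "optimal k b P T x y u \<longleftrightarrow>
        (\<exists>P' \<in> interior (Q2 k b). \<exists>T' x' y' u' t1 s.
            optimal k b P' T' x' y' u' \<and>
            first_leg k b t1 x' y' u' \<and> t1 \<le> s \<and>
            (x' s, y' s) = P \<and>
            is_tail s T x y u T' x' y' u')"
    if "P \<in> open_segment (pt_A k b) (pt_E k b)" for P T x y u
    by (rule segment_optimal_iff_tail[OF k b a that])
qed

end
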